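(* Let $\Omega$ be the set of all triples $\{\varphi\}\ a\ \{\psi\}$ with $a\in\mathsf{Act}$ and $\varphi,\psi\subseteq\mathcal W(\Sigma)$ that are valid. For every well-formed program $C$ and all assertions $\varphi,\psi\subseteq\mathcal W(\Sigma)$: if $\Omega\vdash\{\varphi\}\ C\ \{\psi\}$, then $\vDash\{\varphi\}\ C\ \{\psi\}$.
   Context: Semiring and weights. Let $\mathcal A=\langle U,+,\cdot,\mathbf 0,\mathbf 1\rangle$ be a partial semiring: $\langle U,+,\mathbf 0\rangle$ is a commutative monoid in which $+$ may be partial, $\langle U,\cdot,\mathbf 1\rangle$ is a monoid with $\cdot$ total, $\cdot$ distributes over $+$ on both sides, and $\mathbf 0\cdot u=u\cdot\mathbf 0=\mathbf 0$. Its natural order is $u\le v$ iff $u+w=v$ for some $w$. Assume $\mathcal A$ is naturally ordered ($\le$ is a partial order), Scott continuous (for every directed $D\subseteq U$ and $y\in U$: $\sup_{x\in D}(x+y)=(\sup D)+y$, $\sup_{x\in D}(x\cdot y)=(\sup D)\cdot y$, $\sup_{x\in D}(y\cdot x)=y\cdot\sup D$), and has a top element $\top\ge u$ for all $u\in U$. For a family $(u_i)_{i\in I}$, $\sum_{i\in I}u_i$ is the supremum of all finite sums $u_{i_1}+\dots+u_{i_n}$ over finite $\{i_1,\dots,i_n\}\subseteq I$. For a set $X$, $\mathcal W(X)$ is the set of maps $m:X\to U$ whose support $\mathrm{supp}(m)=\{x: m(x)\ne\mathbf 0\}$ is countable and whose mass $|m|=\sum_{x\in\mathrm{supp}(m)}m(x)$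 is defined. Operations on $\mathcal W(X)$ are pointwise ($(m_1+m_2)(x)=m_1(x)+m_2(x)$, $(u\cdot m)(x)=u\cdot m(x)$, $(m\cdot u)(x)=m(x)\cdot u$, $\mathbf 0(x)=\mathbf 0$), and $m_1\sqsubseteq m_2$ iff $m_1+m=m_2$ for some $m$. Let $\eta(x)(y)=\mathbf 1$ if $x=y$ and $\mathbf 0$ otherwise, and for $f:X\to\mathcal W(Y)$ let $f^\dagger(m)(y)=\sum_{x\in\mathrm{supp}(m)}m(x)\cdot f(x)(y)$. Programs. Fix a set $\Sigma$ of states, a set $\mathsf{Act}$ of atomic actions with interpretation $[\![a]\!]_{\mathsf{Act}}:\Sigma\to\mathcal W(\Sigma)$, and a set $\mathsf{Test}\subseteq 2^\Sigma$ of primitive tests. Programs are $C::=\mathsf{skip}\mid C_1;C_2\mid C_1+C_2\mid\mathsf{assume}\ e\mid C^{\langle e,e'\rangle}\mid a$ with $a\in\mathsf{Act}$; expressions $e::=b\mid u$ with $u\in U$; tests $b::=\mathsf{true}\mid\mathsf{false}\mid b_1\vee b_2\mid b_1\wedge b_2\mid\neg b\mid t$ with $t\in\mathsf{Test}$. A test evaluates to $[\![b]\!](\sigma)\in\{\mathbf 0,\mathbf 1\}$ by ordinary Boolean evaluation ($\mathbf 1$ meaning true) with $[\![t]\!](\sigma)=\mathbf 1$ iff $\sigma\in t$; a weight evaluates to $[\![u]\!](\sigma)=u$. The semantics $[\![C]\!]:\Sigma\to\mathcal W(\Sigma)$ is: $[\![\mathsf{skip}]\!](\sigma)=\eta(\sigma)$;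 $[\![C_1;C_2]\!](\sigma)=[\![C_2]\!]^\dagger([\![C_1]\!](\sigma))$; $[\![C_1+C_2]\!](\sigma)=[\![C_1]\!](\sigma)+[\![C_2]\!](\sigma)$; $[\![a]\!]=[\![a]\!]_{\mathsf{Act}}$; $[\![\mathsf{assume}\ e]\!](\sigma)=[\![e]\!](\sigma)\cdot\eta(\sigma)$; $[\![C^{\langle e,e'\rangle}]\!]$ is the least fixed point (w.r.t. the pointwise order $\sqsubseteq$ on functions $\Sigma\to\mathcal W(\Sigma)$) of $\Phi(f)(\sigma)=[\![e]\!](\sigma)\cdot f^\dagger([\![C]\!](\sigma))+[\![e']\!](\sigma)\cdot\eta(\sigma)$. A program is well-formed if its semantics is a total function. Assertions and triples. Assertions are subsets $\varphi\subseteq\mathcal W(\Sigma)$. For $\phi:T\to 2^{\mathcal W(\Sigma)}$, $\bigoplus_{x\in T}\phi(x)=\{\sum_{t\in T}m_t : m_t\in\phi(t)\text{ for all }t\in T\}$ (over defined sums), and $\varphi\oplus\psi$ is the case $T=\{1,2\}$; $u\odot\varphi=\{u\cdot m: m\in\varphi\}$, $\varphi\odot u=\{m\cdot u: m\in\varphi\}$. The triple $\{\varphi\}\ C\ \{\psi\}$ is valid, written $\vDash\{\varphi\}\ C\ \{\psi\}$, iff $[\![C]\!]^\dagger(m)\in\psi$ for all $m\in\varphi$. Proof system. For a set $\Gamma$ of triples about atomic actions, $\Gamma\vdash\{\varphi\}\ C\ \{\psi\}$ means the triple is derivable using the members of $\Gamma$ as axioms and the following rules (with $\phi,\phi':T\to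 2^{\mathcal W(\Sigma)}$ for arbitrary sets $T$): (Skip) $\{\varphi\}\,\mathsf{skip}\,\{\varphi\}$. (Seq) from $\{\varphi\}C_1\{\vartheta\}$ and $\{\vartheta\}C_2\{\psi\}$ infer $\{\varphi\}C_1;C_2\{\psi\}$. (Plus) from $\{\varphi\}C_1\{\psi_1\}$ and $\{\varphi\}C_2\{\psi_2\}$ infer $\{\varphi\}C_1+C_2\{\psi_1\oplus\psi_2\}$. (Assume) if $[\![e]\!](\sigma)=u$ for all $m\in\varphi$ and all $\sigma\in\mathrm{supp}(m)$, then $\{\varphi\}\,\mathsf{assume}\ e\,\{\varphi\odot u\}$. (Iter) if $(\psi_n)_{n\in\mathbb N}$ converges to $\psi_\infty$ (i.e. whenever $m_n\in\psi_n$ for all $n$, $\sum_{n\in\mathbb N}m_n\in\psi_\infty$) and for all $n\in\mathbb N$ both $\{\varphi_n\}\,\mathsf{assume}\ e;C\,\{\varphi_{n+1}\}$ and $\{\varphi_n\}\,\mathsf{assume}\ e'\,\{\psi_n\}$, then $\{\varphi_0\}\,C^{\langle e,e'\rangle}\,\{\psi_\infty\}$. (False) $\{\emptyset\}C\{\varphi\}$. (True) $\{\varphi\}C\{\mathcal W(\Sigma)\}$. (Scale) from $\{\varphi\}C\{\psi\}$ infer $\{u\odot\varphi\}C\{u\odot\psi\}$. (Disj) from $\{\varphi_1\}C\{\psi_1\}$, $\{\varphi_2\}C\{\psi_2\}$ infer $\{\varphi_1\cup\varphi_2\}C\{\psi_1\cup\psi_2\}$. (Conj) likewise with $\cap$.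 (Choice) from $\{\phi(t)\}C\{\phi'(t)\}$ for all $t\in T$ infer $\{\bigoplus_{x\in T}\phi(x)\}C\{\bigoplus_{x\in T}\phi'(x)\}$. (Exists) from the same premises infer $\{\bigcup_{t\in T}\phi(t)\}C\{\bigcup_{t\in T}\phi'(t)\}$. (Consequence) from $\varphi'\subseteq\varphi$, $\{\varphi\}C\{\psi\}$, $\psi\subseteq\psi'$ infer $\{\varphi'\}C\{\psi'\}$. *)

theory Defs
  imports Main "HOL-Library.Countable_Set"
begin

text \<open>The carrier U is the whole type 'u; addition is partial (None = undefined).\<close>

record 'u psemiring =
  sadd :: "'u \<Rightarrow> 'u \<Rightarrow> 'u option"
  smul :: "'u \<Rightarrow> 'u \<Rightarrow> 'u"
  szero :: 'u
  sone :: 'u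

definition nleq :: "'u psemiring \<Rightarrow> 'u \<Rightarrow> 'u \<Rightarrow> bool" where
  "nleq A u v \<longleftrightarrow> (\<exists>w. sadd A u w = Some v)"

definition is_lub :: "'u psemiring \<Rightarrow> 'u set \<Rightarrow> 'u \<Rightarrow> bool" where
  "is_lub A S s \<longleftrightarrow> (\<forall>x\<in>S. nleq A x s) \<and> (\<forall>b. (\<forall>x\<in>S. nleq A x b) \<longrightarrow> nleq A s b)"

definition psup :: "'u psemiring \<Rightarrow> 'u set \<Rightarrow> 'u option" where
  "psup A S = (if \<exists>s. is_lub A S s then Some (THE s. is_lub A S s) else None)"

definition directed :: "'u psemiring \<Rightarrow> 'u set \<Rightarrow> bool" where
  "directed A D \<longleftrightarrow> D \<noteq> {} \<and> (\<forall>x\<in>D. \<forall>y\<in>D. \<exists>z\<in>D. nleq A x z \<and> nleq A y z)"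

definition partial_semiring :: "'u psemiring \<Rightarrow> bool" where
  "partial_semiring A \<longleftrightarrow>
     (\<forall>x y. sadd A x y = sadd A y x) \<and>
     (\<forall>x y z. Option.bind (sadd A x y) (\<lambda>a. sadd A a z) = Option.bind (sadd A y z) (\<lambda>b. sadd A x b)) \<and>
     (\<forall>x. sadd A x (szero A) = Some x) \<and>
     (\<forall>x y z. smul A (smul A x y) z = smul A x (smul A y z)) \<and>
     (\<forall>x. smul A (sone A) x = x \<and> smul A x (sone A) = x) \<and>
     (\<forall>u v w s. sadd A v w = Some s \<longrightarrow> sadd A (smul A u v) (smul A u w) = Some (smul A u s)) \<and>
     (\<forall>u v w s. sadd A v w = Some s \<longrightarrow> sadd A (smul A v u) (smul A w u) = Some (smul A s u)) \<and>
     (\<forall>u. smul A (szero A) u = szero A \<and> smul A u (szero A) = szero A)"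

definition naturally_ordered :: "'u psemiring \<Rightarrow> bool" where
  "naturally_ordered A \<longleftrightarrow>
     (\<forall>u. nleq A u u) \<and>
     (\<forall>u v w. nleq A u v \<longrightarrow> nleq A v w \<longrightarrow> nleq A u w) \<and>
     (\<forall>u v. nleq A u v \<longrightarrow> nleq A v u \<longrightarrow> u = v)"

text \<open>Scott continuity; the equations are read as Kleene equalities of partial expressions.\<close>
definition scott_continuous :: "'u psemiring \<Rightarrow> bool" where
  "scott_continuous A \<longleftrightarrow>
     (\<forall>D y. directed A D \<longrightarrow>
        (if \<forall>x\<in>D. sadd A x y \<noteq> None then psup A ((\<lambda>x. the (sadd A x y)) ` D) else None)
          = Option.bind (psup A D) (\<lambda>s. sadd A s y)
      \<and> psup A ((\<lambda>x. smul A x y) ` D) = map_option (\<lambda>s. smul A s y) (psup A D)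
      \<and> psup A ((\<lambda>x. smul A y x) ` D) = map_option (\<lambda>s. smul A y s) (psup A D))"

definition has_top :: "'u psemiring \<Rightarrow> bool" where
  "has_top A \<longleftrightarrow> (\<exists>t. \<forall>u. nleq A u t)"

definition standing_assumptions :: "'u psemiring \<Rightarrow> bool" where
  "standing_assumptions A \<longleftrightarrow> partial_semiring A \<and> naturally_ordered A \<and> scott_continuous A \<and> has_top A"

fun fsum_list :: "'u psemiring \<Rightarrow> ('i \<Rightarrow> 'u) \<Rightarrow> 'i list \<Rightarrow> 'u option" where
  "fsum_list A u [] = Some (szero A)"
| "fsum_list A u (i # is) = Option.bind (fsum_list A u is) (\<lambda>s. sadd A (u i) s)"

definition fsum :: "'u psemiring \<Rightarrow> ('i \<Rightarrow> 'u) \<Rightarrow> 'i set \<Rightarrow> 'u option" where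
  "fsum A u F = fsum_list A u (SOME xs. distinct xs \<and> set xs = F)"

definition isum :: "'u psemiring \<Rightarrow> ('i \<Rightarrow> 'u) \<Rightarrow> 'i set \<Rightarrow> 'u option" where
  "isum A u I = (if \<forall>F. finite F \<and> F \<subseteq> I \<longrightarrow> fsum A u F \<noteq> None
                 then psup A {the (fsum A u F) | F. finite F \<and> F \<subseteq> I} else None)"

definition supp :: "'u psemiring \<Rightarrow> ('x \<Rightarrow> 'u) \<Rightarrow> 'x set" where
  "supp A m = {x. m x \<noteq> szero A}"

definition Wt :: "'u psemiring \<Rightarrow> ('x \<Rightarrow> 'u) set" where
  "Wt A = {m. countable (supp A m) \<and> isum A m (supp A m) \<noteq> None}"

definition addW :: "'u psemiring \<Rightarrow> ('x \<Rightarrow> 'u) \<Rightarrow> ('x \<Rightarrow> 'u) \<Rightarrow> ('x \<Rightarrow> 'u) option" where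
  "addW A m1 m2 = (if (\<forall>x. sadd A (m1 x) (m2 x) \<noteq> None) \<and> (\<lambda>x. the (sadd A (m1 x) (m2 x))) \<in> Wt A
                   then Some (\<lambda>x. the (sadd A (m1 x) (m2 x))) else None)"

definition sumW :: "'u psemiring \<Rightarrow> ('i \<Rightarrow> 'x \<Rightarrow> 'u) \<Rightarrow> 'i set \<Rightarrow> ('x \<Rightarrow> 'u) option" where
  "sumW A ms T = (if (\<forall>x. isum A (\<lambda>t. ms t x) T \<noteq> None) \<and> (\<lambda>x. the (isum A (\<lambda>t. ms t x) T)) \<in> Wt A
                  then Some (\<lambda>x. the (isum A (\<lambda>t. ms t x) T)) else None)"

definition lscale :: "'u psemiring \<Rightarrow> 'u \<Rightarrow> ('x \<Rightarrow> 'u) \<Rightarrow> ('x \<Rightarrow> 'u)" where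
  "lscale A u m = (\<lambda>x. smul A u (m x))"

definition rscale :: "'u psemiring \<Rightarrow> ('x \<Rightarrow> 'u) \<Rightarrow> 'u \<Rightarrow> ('x \<Rightarrow> 'u)" where
  "rscale A m u = (\<lambda>x. smul A (m x) u)"

definition eta :: "'u psemiring \<Rightarrow> 'x \<Rightarrow> ('x \<Rightarrow> 'u)" where
  "eta A x = (\<lambda>y. if x = y then sone A else szero A)"

definition bindW :: "'u psemiring \<Rightarrow> ('x \<Rightarrow> 'y \<Rightarrow> 'u) \<Rightarrow> ('x \<Rightarrow> 'u) \<Rightarrow> ('y \<Rightarrow> 'u) option" where
  "bindW A f m = (let r = (\<lambda>y. isum A (\<lambda>x. smul A (m x) (f x y)) (supp A m)) in
                  if (\<forall>y. r y \<noteq> None) \<and> (\<lambda>y. the (r y)) \<in> Wt A then Some (\<lambda>y. the (r y)) else None)"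

definition sqW :: "'u psemiring \<Rightarrow> ('x \<Rightarrow> 'u) \<Rightarrow> ('x \<Rightarrow> 'u) \<Rightarrow> bool" where
  "sqW A m1 m2 \<longleftrightarrow> (\<exists>m\<in>Wt A. addW A m1 m = Some m2)"

definition sqF :: "'u psemiring \<Rightarrow> ('s \<Rightarrow> 'x \<Rightarrow> 'u) \<Rightarrow> ('s \<Rightarrow> 'x \<Rightarrow> 'u) \<Rightarrow> bool" where
  "sqF A f g \<longleftrightarrow> (\<forall>\<sigma>. sqW A (f \<sigma>) (g \<sigma>))"

datatype 't test = TTrue | TFalse | TOr "'t test" "'t test" | TAnd "'t test" "'t test"
  | TNot "'t test" | TPrim 't

datatype ('t, 'u) expr = ETest "'t test" | EWeight 'u

datatype ('a, 't, 'u) prog =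
    Skip
  | Seq "('a, 't, 'u) prog" "('a, 't, 'u) prog"
  | Plus "('a, 't, 'u) prog" "('a, 't, 'u) prog"
  | Assume "('t, 'u) expr"
  | Iter "('a, 't, 'u) prog" "('t, 'u) expr" "('t, 'u) expr"
  | Atom 'a

fun tholds :: "('t \<Rightarrow> 's set) \<Rightarrow> 't test \<Rightarrow> 's \<Rightarrow> bool" where
  "tholds tst TTrue \<sigma> = True"
| "tholds tst TFalse \<sigma> = False"
| "tholds tst (TOr b1 b2) \<sigma> = (tholds tst b1 \<sigma> \<or> tholds tst b2 \<sigma>)"
| "tholds tst (TAnd b1 b2) \<sigma> = (tholds tst b1 \<sigma> \<and> tholds tst b2 \<sigma>)"
| "tholds tst (TNot b) \<sigma> = (\<not> tholds tst b \<sigma>)"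
| "tholds tst (TPrim t) \<sigma> = (\<sigma> \<in> tst t)"

definition evalE :: "'u psemiring \<Rightarrow> ('t \<Rightarrow> 's set) \<Rightarrow> ('t, 'u) expr \<Rightarrow> 's \<Rightarrow> 'u" where
  "evalE A tst e \<sigma> = (case e of ETest b \<Rightarrow> (if tholds tst b \<sigma> then sone A else szero A) | EWeight u \<Rightarrow> u)"

definition liftF :: "('s \<Rightarrow> 'b option) \<Rightarrow> ('s \<Rightarrow> 'b) option" where
  "liftF r = (if \<forall>\<sigma>. r \<sigma> \<noteq> None then Some (\<lambda>\<sigma>. the (r \<sigma>)) else None)"

text \<open>The loop functional Phi (partial), where g is the semantics of the loop body.\<close>
definition Phi :: "'u psemiring \<Rightarrow> ('t \<Rightarrow> 's set) \<Rightarrow> ('s \<Rightarrow> 's \<Rightarrow> 'u) \<Rightarrow> ('t, 'u) expr \<Rightarrow> ('t, 'u) expr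
                   \<Rightarrow> ('s \<Rightarrow> 's \<Rightarrow> 'u) \<Rightarrow> ('s \<Rightarrow> 's \<Rightarrow> 'u) option" where
  "Phi A tst g e e' f = liftF (\<lambda>\<sigma>. Option.bind (bindW A f (g \<sigma>))
        (\<lambda>m. addW A (lscale A (evalE A tst e \<sigma>) m) (lscale A (evalE A tst e' \<sigma>) (eta A \<sigma>))))"

definition lfpW :: "'u psemiring \<Rightarrow> (('s \<Rightarrow> 's \<Rightarrow> 'u) \<Rightarrow> ('s \<Rightarrow> 's \<Rightarrow> 'u) option) \<Rightarrow> ('s \<Rightarrow> 's \<Rightarrow> 'u) option" where
  "lfpW A F = (let FP = {f. (\<forall>\<sigma>. f \<sigma> \<in> Wt A) \<and> F f = Some f} in
     if \<exists>f\<in>FP. \<forall>h\<in>FP. sqF A f h then Some (THE f. f \<in> FP \<and> (\<forall>h\<in>FP. sqF A f h)) else None)"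

text \<open>Semantics; None means the semantics is not a total function (ill-formed program).\<close>
primrec sem :: "'u psemiring \<Rightarrow> ('a \<Rightarrow> 's \<Rightarrow> 's \<Rightarrow> 'u) \<Rightarrow> ('t \<Rightarrow> 's set) \<Rightarrow> ('a, 't, 'u) prog
                 \<Rightarrow> ('s \<Rightarrow> 's \<Rightarrow> 'u) option" where
  "sem A act tst Skip = Some (eta A)"
| "sem A act tst (Seq C1 C2) = (case (sem A act tst C1, sem A act tst C2) of
      (Some f, Some g) \<Rightarrow> liftF (\<lambda>\<sigma>. bindW A g (f \<sigma>)) | _ \<Rightarrow> None)"
| "sem A act tst (Plus C1 C2) = (case (sem A act tst C1, sem A act tst C2) of
      (Some f, Some g) \<Rightarrow> liftF (\<lambda>\<sigma>. addW A (f \<sigma>) (g \<sigma>)) | _ \<Rightarrow> None)"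
| "sem A act tst (Assume e) = Some (\<lambda>\<sigma>. lscale A (evalE A tst e \<sigma>) (eta A \<sigma>))"
| "sem A act tst (Iter C e e') = (case sem A act tst C of
      Some g \<Rightarrow> lfpW A (Phi A tst g e e') | None \<Rightarrow> None)"
| "sem A act tst (Atom a) = Some (act a)"

definition well_formed :: "'u psemiring \<Rightarrow> ('a \<Rightarrow> 's \<Rightarrow> 's \<Rightarrow> 'u) \<Rightarrow> ('t \<Rightarrow> 's set) \<Rightarrow> ('a, 't, 'u) prog \<Rightarrow> bool" where
  "well_formed A act tst C \<longleftrightarrow> sem A act tst C \<noteq> None"

definition valid :: "'u psemiring \<Rightarrow> ('a \<Rightarrow> 's \<Rightarrow> 's \<Rightarrow> 'u) \<Rightarrow> ('t \<Rightarrow> 's set) \<Rightarrow> ('s \<Rightarrow> 'u) set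
                     \<Rightarrow> ('a, 't, 'u) prog \<Rightarrow> ('s \<Rightarrow> 'u) set \<Rightarrow> bool" where
  "valid A act tst \<phi> C \<psi> \<longleftrightarrow>
     (\<exists>f. sem A act tst C = Some f \<and> (\<forall>m\<in>\<phi>. \<exists>m'. bindW A f m = Some m' \<and> m' \<in> \<psi>))"

definition bigoplus :: "'u psemiring \<Rightarrow> ('i \<Rightarrow> ('x \<Rightarrow> 'u) set) \<Rightarrow> 'i set \<Rightarrow> ('x \<Rightarrow> 'u) set" where
  "bigoplus A \<phi> T = {m. \<exists>ms. (\<forall>t\<in>T. ms t \<in> \<phi> t) \<and> sumW A ms T = Some m}"

definition oplus :: "'u psemiring \<Rightarrow> ('x \<Rightarrow> 'u) set \<Rightarrow> ('x \<Rightarrow> 'u) set \<Rightarrow> ('x \<Rightarrow> 'u) set" where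
  "oplus A \<phi> \<psi> = {m. \<exists>m1\<in>\<phi>. \<exists>m2\<in>\<psi>. addW A m1 m2 = Some m}"

definition lscaleS :: "'u psemiring \<Rightarrow> 'u \<Rightarrow> ('x \<Rightarrow> 'u) set \<Rightarrow> ('x \<Rightarrow> 'u) set" where
  "lscaleS A u \<phi> = lscale A u ` \<phi>"

definition rscaleS :: "'u psemiring \<Rightarrow> ('x \<Rightarrow> 'u) set \<Rightarrow> 'u \<Rightarrow> ('x \<Rightarrow> 'u) set" where
  "rscaleS A \<phi> u = (\<lambda>m. rscale A m u) ` \<phi>"

definition converges :: "'u psemiring \<Rightarrow> (nat \<Rightarrow> ('x \<Rightarrow> 'u) set) \<Rightarrow> ('x \<Rightarrow> 'u) set \<Rightarrow> bool" where
  "converges A \<psi>s \<psi>inf \<longleftrightarrow>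
     (\<forall>ms. (\<forall>n. ms n \<in> \<psi>s n) \<longrightarrow> (\<exists>m. sumW A ms (UNIV :: nat set) = Some m \<and> m \<in> \<psi>inf))"

definition Omega :: "'u psemiring \<Rightarrow> ('a \<Rightarrow> 's \<Rightarrow> 's \<Rightarrow> 'u) \<Rightarrow> ('t \<Rightarrow> 's set)
                     \<Rightarrow> (('s \<Rightarrow> 'u) set \<times> 'a \<times> ('s \<Rightarrow> 'u) set) set" where
  "Omega A act tst = {(\<phi>, a, \<psi>). \<phi> \<subseteq> Wt A \<and> \<psi> \<subseteq> Wt A \<and> valid A act tst \<phi> (Atom a) \<psi>}"

text \<open>Derivability. Index sets T of the Choice/Exists rules range over subsets of the type 'i
  (fixed by the phantom argument idx); the theorem quantifies over all such types.\<close>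
inductive derives :: "'u psemiring \<Rightarrow> ('t \<Rightarrow> 's set) \<Rightarrow> (('s \<Rightarrow> 'u) set \<times> 'a \<times> ('s \<Rightarrow> 'u) set) set
    \<Rightarrow> 'i itself \<Rightarrow> ('s \<Rightarrow> 'u) set \<Rightarrow> ('a, 't, 'u) prog \<Rightarrow> ('s \<Rightarrow> 'u) set \<Rightarrow> bool"
  for A :: "'u psemiring" and tst :: "'t \<Rightarrow> 's set"
    and \<Gamma> :: "(('s \<Rightarrow> 'u) set \<times> 'a \<times> ('s \<Rightarrow> 'u) set) set" and idx :: "'i itself"
where
  Ax: "(\<phi>, a, \<psi>) \<in> \<Gamma> \<Longrightarrow> derives A tst \<Gamma> idx \<phi> (Atom a) \<psi>"
| Skip: "\<phi> \<subseteq> Wt A \<Longrightarrow> derives A tst \<Gamma> idx \<phi> Skip \<phi>"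
| Seq: "derives A tst \<Gamma> idx \<phi> C1 \<theta> \<Longrightarrow> derives A tst \<Gamma> idx \<theta> C2 \<psi>
        \<Longrightarrow> derives A tst \<Gamma> idx \<phi> (Seq C1 C2) \<psi>"
| Plus: "derives A tst \<Gamma> idx \<phi> C1 \<psi>1 \<Longrightarrow> derives A tst \<Gamma> idx \<phi> C2 \<psi>2
        \<Longrightarrow> derives A tst \<Gamma> idx \<phi> (Plus C1 C2) (oplus A \<psi>1 \<psi>2)"
| Assume: "\<phi> \<subseteq> Wt A \<Longrightarrow> (\<forall>m\<in>\<phi>. \<forall>\<sigma>\<in>supp A m. evalE A tst e \<sigma> = u)
        \<Longrightarrow> derives A tst \<Gamma> idx \<phi> (Assume e) (rscaleS A \<phi> u)"
| Iter: "converges A \<psi>s \<psi>inf \<Longrightarrow> \<psi>inf \<subseteq> Wt A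
        \<Longrightarrow> (\<forall>n. derives A tst \<Gamma> idx (\<phi>s n) (Seq (Assume e) C) (\<phi>s (Suc n)))
        \<Longrightarrow> (\<forall>n. derives A tst \<Gamma> idx (\<phi>s n) (Assume e') (\<psi>s n))
        \<Longrightarrow> derives A tst \<Gamma> idx (\<phi>s 0) (Iter C e e') \<psi>inf"
| False: "\<phi> \<subseteq> Wt A \<Longrightarrow> derives A tst \<Gamma> idx {} C \<phi>"
| True: "\<phi> \<subseteq> Wt A \<Longrightarrow> derives A tst \<Gamma> idx \<phi> C (Wt A)"
| Scale: "derives A tst \<Gamma> idx \<phi> C \<psi> \<Longrightarrow> derives A tst \<Gamma> idx (lscaleS A u \<phi>) C (lscaleS A u \<psi>)"
| Disj: "derives A tst \<Gamma> idx \<phi>1 C \<psi>1 \<Longrightarrow> derives A tst \<Gamma> idx \<phi>2 C \<psi>2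
        \<Longrightarrow> derives A tst \<Gamma> idx (\<phi>1 \<union> \<phi>2) C (\<psi>1 \<union> \<psi>2)"
| Conj: "derives A tst \<Gamma> idx \<phi>1 C \<psi>1 \<Longrightarrow> derives A tst \<Gamma> idx \<phi>2 C \<psi>2
        \<Longrightarrow> derives A tst \<Gamma> idx (\<phi>1 \<inter> \<phi>2) C (\<psi>1 \<inter> \<psi>2)"
| Choice: "(\<forall>t\<in>(T :: 'i set). derives A tst \<Gamma> idx (\<Phi> t) C (\<Phi>' t))
        \<Longrightarrow> derives A tst \<Gamma> idx (bigoplus A \<Phi> T) C (bigoplus A \<Phi>' T)"
| Exists: "(\<forall>t\<in>(T :: 'i set). derives A tst \<Gamma> idx (\<Phi> t) C (\<Phi>' t))
        \<Longrightarrow> derives A tst \<Gamma> idx (\<Union>t\<in>T. \<Phi> t) C (\<Union>t\<in>T. \<Phi>' t)"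
| Consequence: "\<phi>' \<subseteq> \<phi> \<Longrightarrow> derives A tst \<Gamma> idx \<phi> C \<psi> \<Longrightarrow> \<psi> \<subseteq> \<psi>' \<Longrightarrow> \<phi>' \<subseteq> Wt A \<Longrightarrow> \<psi>' \<subseteq> Wt A
        \<Longrightarrow> derives A tst \<Gamma> idx \<phi>' C \<psi>'"

end

theory Submission
  imports Defs
begin

text \<open>With undefined sums read as infinite, all sums exist, form a continuous commutative monoid
  and satisfy Fubini. Kleisli extension is then associative and commutes with sums and with left
  scaling, which settles every rule except that for loops. For a loop, let
  \<open>w\<^sub>n\<close> collect the runs leaving after exactly \<open>n\<close> iterations. The pointwise sum of the
  \<open>w\<^sub>n\<close> lies below every fixed point and is itself one, so it is the least fixed point, and
  the extension of \<open>w\<^sub>n\<close> applied to \<open>m\<^sub>0\<close> is the exit guard applied to the \<open>n\<close>-th iterate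
  \<open>m\<^sub>n\<close>, hence a member of the \<open>n\<close>-th exit assertion.\<close>

section \<open>Completing the partial addition\<close>

text \<open>\<open>bindW\<close>, \<open>addW\<close>, \<open>sumW\<close> and \<open>liftF\<close>
  are all defined by this conditional. The equivalence reduces each of them to membership in a set
  together with equations at every point.\<close>

lemma Some_the_fun_iff:
  "(if (\<forall>x. r x \<noteq> None) \<and> (\<lambda>x. the (r x)) \<in> W then Some (\<lambda>x. the (r x)) else None) = Some s
    \<longleftrightarrow> s \<in> W \<and> (\<forall>x. r x = Some (s x))"
proof (cases "\<forall>x. r x \<noteq> None")
  case True
  then have "\<exists>q. \<forall>x. r x = Some (q x)" by (intro choice) auto
  then obtain q where "r = (\<lambda>x. Some (q x))" by (auto simp: fun_eq_iff)
  then show ?thesis by (auto simp: fun_eq_iff[symmetric])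
next
  case False
  then obtain x where "r x = None" by blast
  with False show ?thesis by (metis option.distinct(1))
qed

locale weights =
  fixes A :: "'u psemiring"
  assumes standing: "standing_assumptions A"
begin

abbreviation zero ("\<zero>") where "\<zero> \<equiv> szero A"
abbreviation one ("\<one>") where "\<one> \<equiv> sone A"
abbreviation mul (infixl "\<odot>" 70) where "u \<odot> v \<equiv> smul A u v"

section \<open>Laws of the semiring and suprema in the natural order\<close>

lemma sadd_commute: "sadd A x y = sadd A y x"
  and sadd_assoc: "Option.bind (sadd A x y) (\<lambda>a. sadd A a z) = Option.bind (sadd A y z) (\<lambda>b. sadd A x b)"
  and sadd_zero [simp]: "sadd A x \<zero> = Some x"
  and mul_assoc: "u \<odot> v \<odot> w = u \<odot> (v \<odot> w)"
  and mul_one [simp]: "\<one> \<odot> u = u" "u \<odot> \<one> = u"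
  and mul_zero [simp]: "\<zero> \<odot> u = \<zero>" "u \<odot> \<zero> = \<zero>"
  and mul_add_left: "sadd A v w = Some s \<Longrightarrow> sadd A (u \<odot> v) (u \<odot> w) = Some (u \<odot> s)"
  and mul_add_right: "sadd A v w = Some s \<Longrightarrow> sadd A (v \<odot> u) (w \<odot> u) = Some (s \<odot> u)"
  using standing unfolding standing_assumptions_def partial_semiring_def by blast+

lemma sadd_zero_left [simp]: "sadd A \<zero> x = Some x"
  by (simp add: sadd_commute[of \<zero>])

lemma nleq_refl: "nleq A u u"
  and nleq_antisym: "nleq A u v \<Longrightarrow> nleq A v u \<Longrightarrow> u = v"
  using standing unfolding standing_assumptions_def naturally_ordered_def by blast+

lemma scott_mul:
  assumes "directed A D"
  shows "psup A ((\<lambda>x. x \<odot> y) ` D) = map_option (\<lambda>s. s \<odot> y) (psup A D)"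
    and "psup A ((\<lambda>x. y \<odot> x) ` D) = map_option (\<lambda>s. y \<odot> s) (psup A D)"
  using standing assms unfolding standing_assumptions_def scott_continuous_def by blast+

lemma scott_add:
  assumes "directed A D"
  shows "(if \<forall>x\<in>D. sadd A x y \<noteq> None then psup A ((\<lambda>x. the (sadd A x y)) ` D) else None)
          = Option.bind (psup A D) (\<lambda>s. sadd A s y)"
  using standing assms unfolding standing_assumptions_def scott_continuous_def by blast

lemma is_lub_unique: "is_lub A S s \<Longrightarrow> is_lub A S t \<Longrightarrow> s = t"
  unfolding is_lub_def by (blast intro: nleq_antisym)

lemma psup_eq_Some: "psup A S = Some s \<longleftrightarrow> is_lub A S s"
proof
  assume "is_lub A S s"
  then show "psup A S = Some s"
    unfolding psup_def using is_lub_unique by (auto intro: the_equality)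
next
  assume *: "psup A S = Some s"
  then obtain t where t: "is_lub A S t"
    unfolding psup_def by (auto split: if_splits)
  then have "(THE s. is_lub A S s) = t"
    using is_lub_unique by (auto intro: the_equality)
  with * t show "is_lub A S s"
    unfolding psup_def by (auto split: if_splits)
qed

text \<open>Scott continuity of multiplication, as a Kleene equality, forces directed suprema to exist:
  multiply by zero.\<close>

lemma directed_lub_exists:
  assumes "directed A D"
  shows "\<exists>s. is_lub A D s"
proof -
  have "(\<lambda>x. x \<odot> \<zero>) ` D = {\<zero>}"
    using assms unfolding directed_def by auto
  moreover have "is_lub A {\<zero>} \<zero>"
    unfolding is_lub_def by (simp add: nleq_refl)
  ultimately have "psup A D \<noteq> None"
    using scott_mul(1)[OF assms, of \<zero>] psup_eq_Some[of "{\<zero>}" \<zero>] by auto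
  then show ?thesis
    using psup_eq_Some by auto
qed

text \<open>Reading \<^term>\<open>None\<close> as an absorbing infinity turns the partial addition into a total
  commutative monoid, still Scott continuous, in which every family has a sum; a sum of
  weights is undefined iff it is infinite.\<close>

definition oadd :: "'u option \<Rightarrow> 'u option \<Rightarrow> 'u option" (infixl "\<oplus>" 65) where
  "x \<oplus> y = Option.bind x (\<lambda>a. Option.bind y (sadd A a))"

text \<open>The natural order of the completed monoid. It extends \<open>nleq\<close> and has
  \<open>None\<close> as greatest element, so a bound of the form \<open>Some b\<close> is a
  certificate of definedness.\<close>

definition ole :: "'u option \<Rightarrow> 'u option \<Rightarrow> bool" (infix "\<sqsubseteq>" 50) where
  "x \<sqsubseteq> y \<longleftrightarrow> (\<exists>w. x \<oplus> w = y)"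

definition olub :: "'u option set \<Rightarrow> 'u option \<Rightarrow> bool" where
  "olub S s \<longleftrightarrow> (\<forall>x\<in>S. x \<sqsubseteq> s) \<and> (\<forall>b. (\<forall>x\<in>S. x \<sqsubseteq> b) \<longrightarrow> s \<sqsubseteq> b)"

definition odirected :: "'u option set \<Rightarrow> bool" where
  "odirected D \<longleftrightarrow> D \<noteq> {} \<and> (\<forall>x\<in>D. \<forall>y\<in>D. \<exists>z\<in>D. x \<sqsubseteq> z \<and> y \<sqsubseteq> z)"

lemma oadd_simps [simp]:
  "None \<oplus> x = None" "x \<oplus> None = None" "Some a \<oplus> Some b = sadd A a b"
  by (cases x; simp add: oadd_def)+

text \<open>Associativity as a Kleene equality becomes an ordinary equation once \<open>None\<close>
  is absorbing. This makes \<open>osum.F\<close> available for finite sums.\<close>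

sublocale osum: comm_monoid_set oadd "Some \<zero>"
proof
  show "a \<oplus> b \<oplus> c = a \<oplus> (b \<oplus> c)" for a b c
    using sadd_assoc unfolding oadd_def by (cases a; cases b; cases c; simp)
  show "a \<oplus> b = b \<oplus> a" for a b
    by (cases a; cases b; simp add: sadd_commute)
  show "a \<oplus> Some \<zero> = a" for a
    by (cases a; simp)
qed

section \<open>The order of the completion\<close>

lemma ole_None [simp]: "x \<sqsubseteq> None"
  unfolding ole_def by (metis oadd_simps(2))

lemma None_ole [simp]: "None \<sqsubseteq> x \<longleftrightarrow> x = None"
  unfolding ole_def by auto

lemma ole_defined: "x \<sqsubseteq> y \<Longrightarrow> y \<noteq> None \<Longrightarrow> x \<noteq> None"
  by (metis None_ole)

lemma ole_Some [simp]: "Some a \<sqsubseteq> Some b \<longleftrightarrow> nleq A a b"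
proof
  assume "Some a \<sqsubseteq> Some b"
  then obtain w where "Some a \<oplus> w = Some b"
    unfolding ole_def by blast
  then show "nleq A a b"
    unfolding nleq_def by (cases w) auto
next
  assume "nleq A a b"
  then show "Some a \<sqsubseteq> Some b"
    unfolding ole_def nleq_def by (metis oadd_simps(3))
qed

lemma ole_refl [simp]: "x \<sqsubseteq> x"
  unfolding ole_def by (metis osum.right_neutral)

lemma ole_trans [trans]: "x \<sqsubseteq> y \<Longrightarrow> y \<sqsubseteq> z \<Longrightarrow> x \<sqsubseteq> z"
  unfolding ole_def by (metis osum.assoc)

lemma ole_antisym: "x \<sqsubseteq> y \<Longrightarrow> y \<sqsubseteq> x \<Longrightarrow> x = y"
  by (cases x; cases y; simp add: nleq_antisym)

lemma ole_oadd: "x \<sqsubseteq> x \<oplus> y"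
  unfolding ole_def by blast

lemma oadd_mono: "x \<sqsubseteq> x' \<Longrightarrow> y \<sqsubseteq> y' \<Longrightarrow> x \<oplus> y \<sqsubseteq> x' \<oplus> y'"
  unfolding ole_def by (metis osum.assoc osum.commute)

lemma olub_unique: "olub S s \<Longrightarrow> olub S t \<Longrightarrow> s = t"
  unfolding olub_def by (blast intro: ole_antisym)

lemma olub_None: "None \<in> S \<Longrightarrow> olub S None"
  unfolding olub_def by auto

text \<open>The completion adds one new upper bound, \<open>None\<close>, and it lies above
  everything, so a least upper bound stays least.\<close>

lemma olub_Some_image: "D \<noteq> {} \<Longrightarrow> is_lub A D s \<Longrightarrow> olub (Some ` D) (Some s)"
  unfolding olub_def is_lub_def
  by (metis (no_types, opaque_lifting) image_iff None_ole not_Some_eq ole_None ole_Some)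

lemma directed_of_odirected: "odirected (Some ` D) \<Longrightarrow> directed A D"
  unfolding odirected_def directed_def by simp

text \<open>Directed suprema always exist in the completion: either \<open>None\<close> is a member
  and therefore the supremum, or all members are defined and \<open>directed_lub_exists\<close>
  applies.\<close>

lemma odirected_cases:
  assumes "odirected D"
  obtains (undef) "None \<in> D" "olub D None"
  | (def) D' s where "D = Some ` D'" "directed A D'" "is_lub A D' s" "olub D (Some s)"
proof (cases "None \<in> D")
  case True
  with olub_None show thesis by (blast intro: undef)
next
  case False
  then have "x = Some (the x)" if "x \<in> D" for x
    using that by (cases x) auto
  then have D: "D = Some ` (the ` D)"
    unfolding image_image by (metis (no_types, lifting) image_cong image_ident)
  with assms have dir: "directed A (the ` D)"
    using directed_of_odirected by metis
  then obtain s where s: "is_lub A (the ` D) s"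
    using directed_lub_exists by blast
  have "the ` D \<noteq> {}" using dir unfolding directed_def by blast
  from olub_Some_image[OF this s] D have "olub D (Some s)" by simp
  then show thesis using def D dir s by blast
qed

text \<open>Scott continuity of addition survives the completion, because the Kleene equality in
  \<open>scott_add\<close> also fixes when the sum at the supremum is undefined.\<close>

lemma olub_oadd:
  assumes D: "odirected D" and s: "olub D s"
  shows "olub ((\<lambda>x. x \<oplus> y) ` D) (s \<oplus> y)"
  using D
proof (cases rule: odirected_cases)
  case undef
  with s have "s = None" using olub_unique by blast
  moreover have "None \<in> (\<lambda>x. x \<oplus> y) ` D"
    using undef(1) by (metis image_eqI oadd_simps(1))
  ultimately show ?thesis by (simp add: olub_None)
next
  case (def D' t)
  have ne: "D' \<noteq> {}" using def(2) unfolding directed_def by blast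
  have st: "s = Some t" using def s olub_unique by blast
  show ?thesis
  proof (cases y)
    case None
    with ne have "None \<in> (\<lambda>x. x \<oplus> y) ` D" using def(1) by auto
    then show ?thesis using None by (simp add: olub_None)
  next
    case (Some b)
    \<comment> \<open>Since \<open>D'\<close> has supremum \<open>t\<close>, the right-hand side of
      \<open>scott_add\<close> is the sum at \<open>t\<close>. A single undefined sum
      \<open>sadd A x b\<close> makes it undefined.\<close>
    have tb: "(if \<forall>x\<in>D'. sadd A x b \<noteq> None then psup A ((\<lambda>x. the (sadd A x b)) ` D') else None)
        = sadd A t b"
      using scott_add[OF def(2), of b] def(3) psup_eq_Some by (metis Option.bind.bind_lunit)
    have img: "(\<lambda>x. x \<oplus> y) ` D = (\<lambda>x. sadd A x b) ` D'"
      using def(1) Some by (simp add: image_image)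
    show ?thesis
    proof (cases "\<forall>x\<in>D'. sadd A x b \<noteq> None")
      case True
      let ?E = "(\<lambda>x. the (sadd A x b)) ` D'"
      have E: "(\<lambda>x. x \<oplus> y) ` D = Some ` ?E"
        unfolding img image_image using True by (auto intro!: image_cong)
      \<comment> \<open>Translation is monotone, so the translated set is again directed and has a
        supremum; \<open>tb\<close> then shows that the sum at \<open>t\<close> is defined.\<close>
      have "odirected (Some ` ?E)"
        unfolding E[symmetric] odirected_def
      proof (intro conjI ballI)
        show "(\<lambda>x. x \<oplus> y) ` D \<noteq> {}" using D unfolding odirected_def by blast
        fix p q assume "p \<in> (\<lambda>x. x \<oplus> y) ` D" "q \<in> (\<lambda>x. x \<oplus> y) ` D"
        then obtain p' q' where *: "p' \<in> D" "q' \<in> D" "p = p' \<oplus> y" "q = q' \<oplus> y" by blast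
        then obtain z where "z \<in> D" "p' \<sqsubseteq> z" "q' \<sqsubseteq> z"
          using D unfolding odirected_def by blast
        then show "\<exists>z\<in>(\<lambda>x. x \<oplus> y) ` D. p \<sqsubseteq> z \<and> q \<sqsubseteq> z"
          using * oadd_mono[OF _ ole_refl[of y]] by blast
      qed
      then have "directed A ?E" by (rule directed_of_odirected)
      then obtain r where r: "is_lub A ?E r" using directed_lub_exists by blast
      then have "sadd A t b = Some r" using tb True psup_eq_Some by metis
      moreover have "olub (Some ` ?E) (Some r)" by (rule olub_Some_image[OF _ r]) (use ne in simp)
      ultimately show ?thesis using E st Some by simp
    next
      case False
      then have "sadd A t b = None" using tb by presburger
      moreover have "None \<in> (\<lambda>x. x \<oplus> y) ` D"
        using False unfolding img by (metis image_eqI)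
      ultimately show ?thesis using st Some by (simp add: olub_None)
    qed
  qed
qed

section \<open>Infinite sums\<close>

text \<open>Total counterpart of \<open>isum\<close>. The terms are completed weights, so sums can
  be nested, and a divergent sum has the value \<open>None\<close>.\<close>

definition Sm :: "('i \<Rightarrow> 'u option) \<Rightarrow> 'i set \<Rightarrow> 'u option" where
  "Sm g I = (THE s. olub {osum.F g F | F. finite F \<and> F \<subseteq> I} s)"

lemma finite_sum_mono_set:
  assumes "finite G" "F \<subseteq> G"
  shows "osum.F g F \<sqsubseteq> osum.F g G"
proof -
  have "osum.F g G = osum.F g F \<oplus> osum.F g (G - F)"
    using osum.subset_diff[OF assms(2,1), of g] by (simp add: osum.commute)
  then show ?thesis by (simp add: ole_oadd)
qed

lemma odirected_finite_sums: "odirected {osum.F g F | F. finite F \<and> F \<subseteq> I}"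
  unfolding odirected_def
proof (intro conjI ballI)
  show "{osum.F g F | F. finite F \<and> F \<subseteq> I} \<noteq> {}" by blast
  fix x y assume "x \<in> {osum.F g F | F. finite F \<and> F \<subseteq> I}" "y \<in> {osum.F g F | F. finite F \<and> F \<subseteq> I}"
  then obtain F G where *: "finite F" "F \<subseteq> I" "x = osum.F g F" "finite G" "G \<subseteq> I" "y = osum.F g G"
    by blast
  then show "\<exists>z\<in>{osum.F g F | F. finite F \<and> F \<subseteq> I}. x \<sqsubseteq> z \<and> y \<sqsubseteq> z"
    by (intro bexI[of _ "osum.F g (F \<union> G)"]) (auto intro: finite_sum_mono_set)
qed

lemma olub_Sm: "olub {osum.F g F | F. finite F \<and> F \<subseteq> I} (Sm g I)"
proof -
  have "\<exists>s. olub {osum.F g F | F. finite F \<and> F \<subseteq> I} s"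
    using odirected_finite_sums[of g I] by (cases rule: odirected_cases) blast+
  then have "\<exists>!s. olub {osum.F g F | F. finite F \<and> F \<subseteq> I} s"
    by (blast intro: olub_unique)
  then show ?thesis
    unfolding Sm_def by (rule theI')
qed

lemma finite_sum_ole_Sm: "finite F \<Longrightarrow> F \<subseteq> I \<Longrightarrow> osum.F g F \<sqsubseteq> Sm g I"
  using olub_Sm[of g I] unfolding olub_def by blast

lemma Sm_least: "(\<And>F. finite F \<Longrightarrow> F \<subseteq> I \<Longrightarrow> osum.F g F \<sqsubseteq> b) \<Longrightarrow> Sm g I \<sqsubseteq> b"
  using olub_Sm[of g I] unfolding olub_def by blast

text \<open>Scott continuity of addition as a bounding principle: a sum plus a constant is the
  supremum of the finite partial sums plus that constant.\<close>

lemma Sm_oadd_least: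
  assumes "\<And>F. finite F \<Longrightarrow> F \<subseteq> I \<Longrightarrow> osum.F g F \<oplus> y \<sqsubseteq> b"
  shows "Sm g I \<oplus> y \<sqsubseteq> b"
proof -
  have "\<forall>x\<in>(\<lambda>x. x \<oplus> y) ` {osum.F g F | F. finite F \<and> F \<subseteq> I}. x \<sqsubseteq> b"
    using assms by blast
  then show ?thesis
    using olub_oadd[OF odirected_finite_sums olub_Sm, of y g I] unfolding olub_def by blast
qed

lemma finite_sum_mono: "(\<And>i. i \<in> F \<Longrightarrow> g i \<sqsubseteq> h i) \<Longrightarrow> osum.F g F \<sqsubseteq> osum.F h F"
  by (induction F rule: infinite_finite_induct) (auto intro: oadd_mono)

lemma Sm_mono:
  assumes "\<And>i. i \<in> I \<Longrightarrow> g i \<sqsubseteq> h i"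
  shows "Sm g I \<sqsubseteq> Sm h I"
proof (rule Sm_least)
  fix F assume F: "finite F" "F \<subseteq> I"
  have "osum.F g F \<sqsubseteq> osum.F h F" using F assms by (blast intro: finite_sum_mono)
  also have "\<dots> \<sqsubseteq> Sm h I" using F by (rule finite_sum_ole_Sm)
  finally show "osum.F g F \<sqsubseteq> Sm h I" .
qed

lemma Sm_cong: "(\<And>i. i \<in> I \<Longrightarrow> g i = h i) \<Longrightarrow> Sm g I = Sm h I"
  by (auto intro!: ole_antisym Sm_mono)

lemma Sm_finite: "finite I \<Longrightarrow> Sm g I = osum.F g I"
  by (intro ole_antisym Sm_least finite_sum_ole_Sm finite_sum_mono_set) auto

lemma Sm_mono_neutral:
  assumes "J \<subseteq> I" and "\<And>i. i \<in> I - J \<Longrightarrow> g i = Some \<zero>"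
  shows "Sm g J = Sm g I"
proof (rule ole_antisym)
  show "Sm g J \<sqsubseteq> Sm g I"
    using assms(1) by (intro Sm_least finite_sum_ole_Sm) auto
  show "Sm g I \<sqsubseteq> Sm g J"
  proof (rule Sm_least)
    fix F assume F: "finite F" "F \<subseteq> I"
    have "osum.F g F = osum.F g (F \<inter> J)"
      using F assms(2) by (intro osum.mono_neutral_right) auto
    also have "\<dots> \<sqsubseteq> Sm g J" using F by (intro finite_sum_ole_Sm) auto
    finally show "osum.F g F \<sqsubseteq> Sm g J" .
  qed
qed

lemma Sm_single:
  assumes "x \<in> I" and "\<And>i. i \<in> I \<Longrightarrow> i \<noteq> x \<Longrightarrow> g i = Some \<zero>"
  shows "Sm g I = g x"
proof -
  have "Sm g I = Sm g {x}"
    using assms by (intro Sm_mono_neutral[symmetric]) auto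
  then show ?thesis by (simp add: Sm_finite)
qed

lemma Sm_zero [simp]: "Sm (\<lambda>i. Some \<zero>) I = Some \<zero>"
  using Sm_mono_neutral[of "{}" I "\<lambda>i. Some \<zero>"] by (simp add: Sm_finite)

lemma ole_Sm: "i \<in> I \<Longrightarrow> g i \<sqsubseteq> Sm g I"
  using finite_sum_ole_Sm[of "{i}" I g] by simp

section \<open>Additivity and exchange of infinite sums\<close>

lemma Sm_oadd: "Sm (\<lambda>i. g i \<oplus> h i) I = Sm g I \<oplus> Sm h I"
proof (rule ole_antisym)
  show "Sm (\<lambda>i. g i \<oplus> h i) I \<sqsubseteq> Sm g I \<oplus> Sm h I"
    by (rule Sm_least) (simp add: osum.distrib oadd_mono finite_sum_ole_Sm)
  show "Sm g I \<oplus> Sm h I \<sqsubseteq> Sm (\<lambda>i. g i \<oplus> h i) I"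
  proof (rule Sm_oadd_least)
    fix F assume F: "finite F" "F \<subseteq> I"
    have "Sm h I \<oplus> osum.F g F \<sqsubseteq> Sm (\<lambda>i. g i \<oplus> h i) I"
    proof (rule Sm_oadd_least)
      fix G assume G: "finite G" "G \<subseteq> I"
      \<comment> \<open>The two partial sums range over unrelated finite sets. Enlarging both to the
        union allows them to be merged term by term.\<close>
      have "osum.F h G \<oplus> osum.F g F \<sqsubseteq> osum.F h (F \<union> G) \<oplus> osum.F g (F \<union> G)"
        using F G by (intro oadd_mono finite_sum_mono_set) auto
      also have "\<dots> = osum.F (\<lambda>i. g i \<oplus> h i) (F \<union> G)"
        by (simp add: osum.distrib osum.commute)
      also have "\<dots> \<sqsubseteq> Sm (\<lambda>i. g i \<oplus> h i) I"
        using F G by (intro finite_sum_ole_Sm) auto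
      finally show "osum.F h G \<oplus> osum.F g F \<sqsubseteq> Sm (\<lambda>i. g i \<oplus> h i) I" .
    qed
    then show "osum.F g F \<oplus> Sm h I \<sqsubseteq> Sm (\<lambda>i. g i \<oplus> h i) I"
      by (simp add: osum.commute)
  qed
qed

lemma finite_sum_Sm:
  "finite F \<Longrightarrow> osum.F (\<lambda>i. Sm (g i) J) F = Sm (\<lambda>j. osum.F (\<lambda>i. g i j) F) J"
  by (induction F rule: finite_induct) (simp_all add: Sm_oadd)

text \<open>A finite outer sum moves inside by \<open>finite_sum_Sm\<close>, and there each finite
  sum is bounded by the full one. The statement is symmetric in the two indices, so it yields Fubini
  by antisymmetry.\<close>

lemma Sm_swap_ole: "Sm (\<lambda>i. Sm (\<lambda>j. g i j) J) I \<sqsubseteq> Sm (\<lambda>j. Sm (\<lambda>i. g i j) I) J"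
  by (rule Sm_least) (auto simp: finite_sum_Sm intro!: Sm_mono finite_sum_ole_Sm)

lemma Sm_swap: "Sm (\<lambda>i. Sm (\<lambda>j. g i j) J) I = Sm (\<lambda>j. Sm (\<lambda>i. g i j) I) J"
  by (rule ole_antisym[OF Sm_swap_ole Sm_swap_ole])

text \<open>The way back from the completion to the carrier: the partial sums form a directed set of
  genuine weights, to which continuity stated with \<open>psup\<close> applies.\<close>

lemma Sm_defined_cases:
  assumes "\<And>F. finite F \<Longrightarrow> F \<subseteq> I \<Longrightarrow> osum.F g F \<noteq> None"
  obtains D s where "{osum.F g F | F. finite F \<and> F \<subseteq> I} = Some ` D" "directed A D"
    "is_lub A D s" "Sm g I = Some s"
  using odirected_finite_sums[of g I]
proof (cases rule: odirected_cases)
  case undef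
  then show thesis using assms by (smt (verit) mem_Collect_eq)
next
  case (def D s)
  then show thesis using that olub_unique[OF def(4) olub_Sm] by simp
qed

text \<open>The map \<open>h\<close> passes through finite sums by induction and through their
  directed supremum by continuity. It will be multiplication by a fixed weight, on either
  side.\<close>

lemma Sm_hom:
  assumes sum: "Sm (\<lambda>i. Some (g i)) I = Some s"
    and zero: "h \<zero> = \<zero>"
    and add: "\<And>v w s. sadd A v w = Some s \<Longrightarrow> sadd A (h v) (h w) = Some (h s)"
    and sup: "\<And>D. directed A D \<Longrightarrow> psup A (h ` D) = map_option h (psup A D)"
  shows "Sm (\<lambda>i. Some (h (g i))) I = Some (h s)"
proof -
  let ?D = "{osum.F (\<lambda>i. Some (g i)) F | F. finite F \<and> F \<subseteq> I}"
  have fin: "osum.F (\<lambda>i. Some (h (g i))) F = map_option h (osum.F (\<lambda>i. Some (g i)) F)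
      \<and> osum.F (\<lambda>i. Some (g i)) F \<noteq> None"
    if "finite F" "F \<subseteq> I" for F
    using that
  proof (induction F rule: finite_induct)
    case empty
    then show ?case by (simp add: zero)
  next
    case (insert x F)
    then obtain r where r: "osum.F (\<lambda>i. Some (g i)) F = Some r" by auto
    \<comment> \<open>A partial sum lies below the defined total and is therefore defined, which
      supplies the premise of \<open>add\<close>.\<close>
    have "osum.F (\<lambda>i. Some (g i)) (insert x F) \<sqsubseteq> Some s"
      using insert.prems insert.hyps sum finite_sum_ole_Sm by (metis finite_insert)
    then obtain q where q: "osum.F (\<lambda>i. Some (g i)) (insert x F) = Some q"
      by (cases "osum.F (\<lambda>i. Some (g i)) (insert x F)") auto
    then have "sadd A (g x) r = Some q" using insert.hyps r by simp
    then show ?case using insert r q add by simp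
  qed
  have "osum.F (\<lambda>i. Some (g i)) F \<noteq> None" if "finite F" "F \<subseteq> I" for F
    using fin that by blast
  then obtain D' t where D': "?D = Some ` D'" "directed A D'" "is_lub A D' t"
    and "Sm (\<lambda>i. Some (g i)) I = Some t"
    by (rule Sm_defined_cases)
  then have "t = s" using sum by simp
  have "psup A (h ` D') = Some (h s)"
    using sup[OF D'(2)] D'(3) \<open>t = s\<close> by (simp add: psup_eq_Some[symmetric])
  then have "is_lub A (h ` D') (h s)" by (simp only: psup_eq_Some)
  moreover have "D' \<noteq> {}" using D'(2) unfolding directed_def by blast
  ultimately have "olub (Some ` h ` D') (Some (h s))" by (intro olub_Some_image) auto
  moreover have "Some ` h ` D' = map_option h ` ?D"
    unfolding D'(1) by (simp add: image_image)
  moreover have "map_option h ` ?D = {osum.F (\<lambda>i. Some (h (g i))) F | F. finite F \<and> F \<subseteq> I}"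
    unfolding setcompr_eq_image image_image using fin by (intro image_cong) simp_all
  ultimately have "olub {osum.F (\<lambda>i. Some (h (g i))) F | F. finite F \<and> F \<subseteq> I} (Some (h s))"
    by argo
  then show ?thesis by (rule olub_unique[OF olub_Sm])
qed

lemma Sm_mul_left:
  "Sm (\<lambda>i. Some (g i)) I = Some s \<Longrightarrow> Sm (\<lambda>i. Some (u \<odot> g i)) I = Some (u \<odot> s)"
  by (erule Sm_hom[where h = "smul A u"]) (simp_all only: mul_zero mul_add_left scott_mul)

lemma Sm_mul_right:
  "Sm (\<lambda>i. Some (g i)) I = Some s \<Longrightarrow> Sm (\<lambda>i. Some (g i \<odot> u)) I = Some (s \<odot> u)"
  by (erule Sm_hom[where h = "\<lambda>x. smul A x u"]) (simp_all only: mul_zero mul_add_right scott_mul)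

section \<open>Agreement with the original finite and infinite sums\<close>

lemma fsum_list_eq: "distinct xs \<Longrightarrow> fsum_list A u xs = osum.F (\<lambda>i. Some (u i)) (set xs)"
proof (induction xs)
  case (Cons a xs)
  then show ?case
    by (cases "osum.F (\<lambda>i. Some (u i)) (set xs)") auto
qed simp

text \<open>\<open>fsum\<close> adds along some chosen enumeration; by commutativity all
  enumerations give the same value.\<close>

lemma fsum_eq: "finite F \<Longrightarrow> fsum A u F = osum.F (\<lambda>i. Some (u i)) F"
  unfolding fsum_def
  by (rule someI2_ex) (use finite_distinct_list fsum_list_eq in blast)+

text \<open>An undefined finite partial sum makes both sides \<open>None\<close>. Otherwise both
  sides are the supremum of the same directed set of weights.\<close>

lemma isum_eq: "isum A u I = Sm (\<lambda>i. Some (u i)) I"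
proof -
  let ?g = "\<lambda>i. Some (u i)"
  let ?D = "{osum.F ?g F | F. finite F \<and> F \<subseteq> I}"
  show ?thesis
  proof (cases "\<forall>F. finite F \<and> F \<subseteq> I \<longrightarrow> fsum A u F \<noteq> None")
    case False
    then obtain F where "finite F" "F \<subseteq> I" "osum.F ?g F = None"
      using fsum_eq by metis
    then have "Sm ?g I = None" using finite_sum_ole_Sm[of F I ?g] by simp
    then show ?thesis unfolding isum_def if_not_P[OF False] by simp
  next
    case True
    have "osum.F ?g F \<noteq> None" if "finite F" "F \<subseteq> I" for F
      unfolding fsum_eq[OF that(1), symmetric] using True that by blast
    then obtain D' t where D': "?D = Some ` D'" "directed A D'" "is_lub A D' t" "Sm ?g I = Some t"
      by (rule Sm_defined_cases)
    have "{the (fsum A u F) | F. finite F \<and> F \<subseteq> I} = the ` ?D"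
      unfolding setcompr_eq_image image_image by (rule image_cong) (simp_all add: fsum_eq)
    also have "\<dots> = D'" unfolding D'(1) by (simp add: image_image)
    finally have "isum A u I = psup A D'" unfolding isum_def if_P[OF True] by (rule arg_cong)
    also have "\<dots> = Sm ?g I" using D'(3,4) psup_eq_Some by simp
    finally show ?thesis .
  qed
qed

text \<open>Additivity applied to a splitting of \<open>g\<close> into a family concentrated at
  \<open>x\<close> and one that is zero there.\<close>

lemma Sm_insert:
  assumes "x \<notin> I"
  shows "Sm g (insert x I) = g x \<oplus> Sm g I"
proof -
  let ?a = "\<lambda>i. if i = x then g x else Some \<zero>"
  let ?b = "\<lambda>i. if i = x then Some \<zero> else g i"
  have "Sm g (insert x I) = Sm (\<lambda>i. ?a i \<oplus> ?b i) (insert x I)"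
    by (rule Sm_cong) simp
  also have "\<dots> = Sm ?a (insert x I) \<oplus> Sm ?b (insert x I)"
    by (rule Sm_oadd)
  also have "Sm ?a (insert x I) = g x"
    by (subst Sm_single[of x]) auto
  also have "Sm ?b (insert x I) = Sm ?b I"
    by (rule Sm_mono_neutral[symmetric]) auto
  also have "Sm ?b I = Sm g I"
    using assms by (intro Sm_cong) auto
  finally show ?thesis .
qed

lemma Sm_reindex:
  assumes "inj_on f I"
  shows "Sm g (f ` I) = Sm (\<lambda>i. g (f i)) I"
proof (rule ole_antisym)
  have *: "osum.F g (f ` F) = osum.F (\<lambda>i. g (f i)) F" if "F \<subseteq> I" for F
    using osum.reindex[OF inj_on_subset[OF assms that], of g] by (simp add: comp_def)
  show "Sm g (f ` I) \<sqsubseteq> Sm (\<lambda>i. g (f i)) I"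
  proof (rule Sm_least)
    fix F assume "finite F" "F \<subseteq> f ` I"
    then obtain G where "finite G" "G \<subseteq> I" "F = f ` G"
      by (metis finite_subset_image)
    then show "osum.F g F \<sqsubseteq> Sm (\<lambda>i. g (f i)) I"
      by (simp add: * finite_sum_ole_Sm)
  qed
  show "Sm (\<lambda>i. g (f i)) I \<sqsubseteq> Sm g (f ` I)"
    by (rule Sm_least) (simp add: *[symmetric] finite_sum_ole_Sm image_mono)
qed

text \<open>In the loop argument the term at 0 is the immediate exit, and the shifted sum collects
  the runs that perform at least one iteration.\<close>

lemma Sm_nat: "Sm g UNIV = g 0 \<oplus> Sm (\<lambda>n. g (Suc n)) UNIV"
proof -
  have "insert 0 (range Suc) = UNIV" using not0_implies_Suc by blast
  then show ?thesis
    using Sm_insert[of 0 "range Suc" g] Sm_reindex[of Suc UNIV g] by simp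
qed

lemma Sm_lessThan_Suc: "Sm g {..<Suc N} = g 0 \<oplus> Sm (\<lambda>n. g (Suc n)) {..<N}"
  using Sm_insert[of 0 "Suc ` {..<N}" g] Sm_reindex[of Suc "{..<N}" g]
  by (simp add: lessThan_Suc_eq_insert_0)

section \<open>Weighted sets and Kleisli extension\<close>

text \<open>Terms outside the support are zero. Summing over the whole type keeps the index set
  fixed, so that sums can be exchanged freely.\<close>

lemma isum_supp: "isum A m (supp A m) = Sm (\<lambda>x. Some (m x)) UNIV"
  unfolding isum_eq by (rule Sm_mono_neutral) (auto simp: supp_def)

lemma Wt_iff: "m \<in> Wt A \<longleftrightarrow> countable (supp A m) \<and> Sm (\<lambda>x. Some (m x)) UNIV \<noteq> None"
  unfolding Wt_def isum_supp by simp

lemma bindW_eq_Some: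
  "bindW A f m = Some r \<longleftrightarrow> r \<in> Wt A \<and> (\<forall>y. Sm (\<lambda>x. Some (m x \<odot> f x y)) UNIV = Some (r y))"
proof -
  have "isum A (\<lambda>x. m x \<odot> f x y) (supp A m) = Sm (\<lambda>x. Some (m x \<odot> f x y)) UNIV" for y
    unfolding isum_eq by (rule Sm_mono_neutral) (auto simp: supp_def)
  then show ?thesis
    unfolding bindW_def Let_def Some_the_fun_iff by simp
qed

lemma addW_eq_Some:
  "addW A m1 m2 = Some r \<longleftrightarrow> r \<in> Wt A \<and> (\<forall>x. sadd A (m1 x) (m2 x) = Some (r x))"
  unfolding addW_def by (rule Some_the_fun_iff)

lemma sumW_eq_Some:
  "sumW A ms T = Some r \<longleftrightarrow> r \<in> Wt A \<and> (\<forall>x. Sm (\<lambda>t. Some (ms t x)) T = Some (r x))"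
  unfolding sumW_def isum_eq by (rule Some_the_fun_iff)

lemma nleq_mul_left: "nleq A u v \<Longrightarrow> nleq A (w \<odot> u) (w \<odot> v)"
  unfolding nleq_def using mul_add_left by blast

lemma zero_nleq: "nleq A \<zero> u"
  unfolding nleq_def by auto

text \<open>Zero is the least weight, so \<open>m\<close> vanishes wherever \<open>m'\<close> does,
  and the mass of \<open>m\<close> is bounded by a defined mass.\<close>

lemma Wt_downward:
  assumes "m' \<in> Wt A" and "\<And>x. nleq A (m x) (m' x)"
  shows "m \<in> Wt A"
proof -
  have "supp A m \<subseteq> supp A m'"
    unfolding supp_def using assms(2) by (metis (mono_tags, lifting) Collect_mono nleq_antisym zero_nleq)
  moreover have "Sm (\<lambda>x. Some (m x)) UNIV \<sqsubseteq> Sm (\<lambda>x. Some (m' x)) UNIV"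
    by (rule Sm_mono) (simp add: assms(2))
  ultimately show ?thesis
    using assms(1) ole_defined countable_subset unfolding Wt_iff by metis
qed

lemma eta_Wt: "eta A x \<in> Wt A"
proof -
  have "supp A (eta A x) \<subseteq> {x}"
    unfolding supp_def eta_def by auto
  then have "countable (supp A (eta A x))"
    by (rule countable_subset) simp
  moreover have "Sm (\<lambda>y. Some (eta A x y)) UNIV = Some \<one>"
    by (subst Sm_single[of x]) (auto simp: eta_def)
  ultimately show ?thesis unfolding Wt_iff by simp
qed

lemma lscale_Wt:
  assumes "m \<in> Wt A"
  shows "lscale A u m \<in> Wt A"
proof -
  have "supp A (lscale A u m) \<subseteq> supp A m"
    unfolding supp_def lscale_def by auto
  moreover obtain M where "Sm (\<lambda>x. Some (m x)) UNIV = Some M"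
    using assms unfolding Wt_iff by auto
  then have "Sm (\<lambda>x. Some (lscale A u m x)) UNIV = Some (u \<odot> M)"
    unfolding lscale_def by (rule Sm_mul_left)
  ultimately show ?thesis
    using assms unfolding Wt_iff by (auto intro: countable_subset)
qed

lemma rscale_Wt:
  assumes "m \<in> Wt A"
  shows "rscale A m u \<in> Wt A"
proof -
  have "supp A (rscale A m u) \<subseteq> supp A m"
    unfolding supp_def rscale_def by auto
  moreover obtain M where "Sm (\<lambda>x. Some (m x)) UNIV = Some M"
    using assms unfolding Wt_iff by auto
  then have "Sm (\<lambda>x. Some (rscale A m u x)) UNIV = Some (M \<odot> u)"
    unfolding rscale_def by (rule Sm_mul_right)
  ultimately show ?thesis
    using assms unfolding Wt_iff by (auto intro: countable_subset)
qed

definition kernel :: "('x \<Rightarrow> 'y \<Rightarrow> 'u) \<Rightarrow> bool" where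
  "kernel f \<longleftrightarrow> (\<forall>x. f x \<in> Wt A)"

text \<open>The masses of the \<^term>\<open>f x\<close> are bounded by the top weight, so the mass of the result is
  bounded by the mass of \<^term>\<open>m\<close> times top.\<close>

lemma bindW_total:
  assumes m: "m \<in> Wt A" and f: "kernel f"
  shows "\<exists>r. bindW A f m = Some r"
proof -
  obtain t where t: "\<And>u. nleq A u t"
    using standing unfolding standing_assumptions_def has_top_def by blast
  obtain M where "Sm (\<lambda>x. Some (m x)) UNIV = Some M"
    using m unfolding Wt_iff by auto
  then have M: "Sm (\<lambda>x. Some (m x \<odot> t)) UNIV = Some (M \<odot> t)"
    by (rule Sm_mul_right)
  have "\<exists>\<mu>. \<forall>x. Sm (\<lambda>y. Some (f x y)) UNIV = Some (\<mu> x)"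
    using f unfolding kernel_def Wt_iff by (intro choice) auto
  then obtain \<mu> where \<mu>: "\<And>x. Sm (\<lambda>y. Some (f x y)) UNIV = Some (\<mu> x)" by blast
  let ?s = "\<lambda>y. Sm (\<lambda>x. Some (m x \<odot> f x y)) UNIV"
  have "Sm ?s UNIV = Sm (\<lambda>x. Sm (\<lambda>y. Some (m x \<odot> f x y)) UNIV) UNIV"
    by (rule Sm_swap)
  also have "\<dots> = Sm (\<lambda>x. Some (m x \<odot> \<mu> x)) UNIV"
    by (intro Sm_cong Sm_mul_left \<mu>)
  also have "\<dots> \<sqsubseteq> Some (M \<odot> t)"
    unfolding M[symmetric] by (rule Sm_mono) (simp add: nleq_mul_left t)
  finally have fin: "Sm ?s UNIV \<noteq> None" by (rule ole_defined) simp
  \<comment> \<open>Each single coordinate lies below the total mass, which has just been shown to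
    be defined.\<close>
  have "?s y \<noteq> None" for y
    by (rule ole_defined[OF ole_Sm fin]) simp
  then have r: "?s y = Some (the (?s y))" for y by simp
  \<comment> \<open>Countability of the support: at a point outside this union every term of the sum
    is zero.\<close>
  have "supp A (\<lambda>y. the (?s y)) \<subseteq> (\<Union>x\<in>supp A m. supp A (f x))"
  proof (rule subsetI, rule ccontr)
    fix y assume y: "y \<in> supp A (\<lambda>y. the (?s y))" and "y \<notin> (\<Union>x\<in>supp A m. supp A (f x))"
    then have "m x \<odot> f x y = \<zero>" for x
      unfolding supp_def by (cases "m x = \<zero>") auto
    with y show False unfolding supp_def by simp
  qed
  moreover have "countable (\<Union>x\<in>supp A m. supp A (f x))"
    using m f unfolding kernel_def Wt_iff by blast
  ultimately have "countable (supp A (\<lambda>y. the (?s y)))" by (rule countable_subset)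
  moreover have "Sm (\<lambda>y. Some (the (?s y))) UNIV \<noteq> None"
    unfolding r[symmetric] by (rule fin)
  ultimately have "(\<lambda>y. the (?s y)) \<in> Wt A" unfolding Wt_iff by blast
  with r show ?thesis unfolding bindW_eq_Some by blast
qed

text \<open>Total version of \<open>bindW\<close>. On weighted maps and kernels the value under
  \<open>the\<close> exists by \<open>bindW_total\<close>.\<close>

definition bnd :: "('x \<Rightarrow> 'y \<Rightarrow> 'u) \<Rightarrow> ('x \<Rightarrow> 'u) \<Rightarrow> ('y \<Rightarrow> 'u)" where
  "bnd f m = the (bindW A f m)"

lemma bindW_bnd: "m \<in> Wt A \<Longrightarrow> kernel f \<Longrightarrow> bindW A f m = Some (bnd f m)"
  using bindW_total unfolding bnd_def by fastforce

lemma bnd_Wt: "m \<in> Wt A \<Longrightarrow> kernel f \<Longrightarrow> bnd f m \<in> Wt A"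
  using bindW_bnd bindW_eq_Some by blast

lemma Sm_bnd: "m \<in> Wt A \<Longrightarrow> kernel f \<Longrightarrow> Sm (\<lambda>x. Some (m x \<odot> f x y)) UNIV = Some (bnd f m y)"
  using bindW_bnd bindW_eq_Some by blast

lemma bnd_eqI:
  assumes "\<And>y. Sm (\<lambda>x. Some (m x \<odot> f x y)) UNIV = Some (r y)" and "m \<in> Wt A" and "kernel f"
  shows "bnd f m = r"
proof
  fix y
  have "Some (bnd f m y) = Some (r y)"
    using Sm_bnd[OF assms(2,3), of y] assms(1)[of y] by (rule subst)
  then show "bnd f m y = r y" by (rule option.inject[THEN iffD1])
qed

text \<open>The weights of \<open>m\<close> stand to the left of those of \<open>f\<close>, so a
  left factor is pulled out by associativity and distributivity over infinite sums.\<close>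

lemma bnd_lscale:
  assumes "m \<in> Wt A" "kernel f"
  shows "bnd f (lscale A u m) = lscale A u (bnd f m)"
proof (rule bnd_eqI)
  show "Sm (\<lambda>x. Some (lscale A u m x \<odot> f x y)) UNIV = Some (lscale A u (bnd f m) y)" for y
    unfolding lscale_def mul_assoc by (intro Sm_mul_left Sm_bnd assms)
qed (use assms lscale_Wt in auto)

text \<open>Associativity of Kleisli extension. Distributivity on the right and on the left turns
  the two sides into the same double sum with the order of summation exchanged.\<close>

lemma bnd_bnd:
  assumes m: "m \<in> Wt A" and f: "kernel f" and g: "kernel g"
  shows "bnd g (bnd f m) = bnd (\<lambda>x. bnd g (f x)) m"
proof (rule bnd_eqI)
  fix z
  have h: "kernel (\<lambda>x. bnd g (f x))"
    using f g bnd_Wt unfolding kernel_def by blast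
  have "Sm (\<lambda>y. Some (bnd f m y \<odot> g y z)) UNIV
      = Sm (\<lambda>y. Sm (\<lambda>x. Some (m x \<odot> f x y \<odot> g y z)) UNIV) UNIV"
    by (intro Sm_cong Sm_mul_right[symmetric] Sm_bnd m f)
  also have "\<dots> = Sm (\<lambda>x. Sm (\<lambda>y. Some (m x \<odot> f x y \<odot> g y z)) UNIV) UNIV"
    by (rule Sm_swap)
  also have "\<dots> = Sm (\<lambda>x. Some (m x \<odot> bnd g (f x) z)) UNIV"
    unfolding mul_assoc using f g by (intro Sm_cong Sm_mul_left Sm_bnd) (auto simp: kernel_def)
  also have "\<dots> = Some (bnd (\<lambda>x. bnd g (f x)) m z)"
    by (rule Sm_bnd[OF m h])
  finally show "Sm (\<lambda>y. Some (bnd f m y \<odot> g y z)) UNIV = Some (bnd (\<lambda>x. bnd g (f x)) m z)" .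
qed (use assms bnd_Wt in auto)

text \<open>Linearity in the argument, by Fubini and right distributivity; it serves the rule
  \<open>Choice\<close>.\<close>

lemma sumW_bnd_left:
  assumes sum: "sumW A ms T = Some m" and ms: "\<And>t. t \<in> T \<Longrightarrow> ms t \<in> Wt A" and f: "kernel f"
  shows "sumW A (\<lambda>t. bnd f (ms t)) T = Some (bnd f m)"
proof -
  have m: "m \<in> Wt A" and eq: "\<And>x. Sm (\<lambda>t. Some (ms t x)) T = Some (m x)"
    using sum unfolding sumW_eq_Some by auto
  have "Sm (\<lambda>t. Some (bnd f (ms t) y)) T = Some (bnd f m y)" for y
  proof -
    have "Sm (\<lambda>t. Some (bnd f (ms t) y)) T = Sm (\<lambda>t. Sm (\<lambda>x. Some (ms t x \<odot> f x y)) UNIV) T"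
      by (intro Sm_cong Sm_bnd[symmetric] ms f)
    also have "\<dots> = Sm (\<lambda>x. Sm (\<lambda>t. Some (ms t x \<odot> f x y)) T) UNIV"
      by (rule Sm_swap)
    also have "\<dots> = Sm (\<lambda>x. Some (m x \<odot> f x y)) UNIV"
      by (intro Sm_cong Sm_mul_right eq)
    also have "\<dots> = Some (bnd f m y)"
      by (rule Sm_bnd[OF m f])
    finally show ?thesis .
  qed
  then show ?thesis
    unfolding sumW_eq_Some using bnd_Wt[OF m f] by blast
qed

text \<open>Linearity in the kernel, by Fubini and left distributivity; it splits the effect of a
  loop according to the number of iterations.\<close>

lemma sumW_bnd_right:
  assumes sum: "\<And>x. sumW A (\<lambda>t. ks t x) T = Some (f x)" and ks: "\<And>t. t \<in> T \<Longrightarrow> kernel (ks t)"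
    and m: "m \<in> Wt A"
  shows "sumW A (\<lambda>t. bnd (ks t) m) T = Some (bnd f m)"
proof -
  have f: "kernel f" and eq: "\<And>x y. Sm (\<lambda>t. Some (ks t x y)) T = Some (f x y)"
    using sum unfolding sumW_eq_Some kernel_def by auto
  have "Sm (\<lambda>t. Some (bnd (ks t) m y)) T = Some (bnd f m y)" for y
  proof -
    have "Sm (\<lambda>t. Some (bnd (ks t) m y)) T = Sm (\<lambda>t. Sm (\<lambda>x. Some (m x \<odot> ks t x y)) UNIV) T"
      by (intro Sm_cong Sm_bnd[symmetric] ks m)
    also have "\<dots> = Sm (\<lambda>x. Sm (\<lambda>t. Some (m x \<odot> ks t x y)) T) UNIV"
      by (rule Sm_swap)
    also have "\<dots> = Sm (\<lambda>x. Some (m x \<odot> f x y)) UNIV"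
      by (intro Sm_cong Sm_mul_left eq)
    also have "\<dots> = Some (bnd f m y)"
      by (rule Sm_bnd[OF m f])
    finally show ?thesis .
  qed
  then show ?thesis
    unfolding sumW_eq_Some using bnd_Wt[OF m f] by blast
qed

lemma addW_bnd:
  assumes add: "\<And>x. addW A (f x) (g x) = Some (h x)" and f: "kernel f" and g: "kernel g"
    and m: "m \<in> Wt A"
  shows "addW A (bnd f m) (bnd g m) = Some (bnd h m)"
proof -
  have h: "kernel h" and eq: "\<And>x y. sadd A (f x y) (g x y) = Some (h x y)"
    using add unfolding addW_eq_Some kernel_def by auto
  have "sadd A (bnd f m y) (bnd g m y) = Some (bnd h m y)" for y
  proof -
    have "sadd A (bnd f m y) (bnd g m y)
        = Sm (\<lambda>x. Some (m x \<odot> f x y)) UNIV \<oplus> Sm (\<lambda>x. Some (m x \<odot> g x y)) UNIV"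
      by (simp add: Sm_bnd m f g)
    also have "\<dots> = Sm (\<lambda>x. Some (m x \<odot> f x y) \<oplus> Some (m x \<odot> g x y)) UNIV"
      by (rule Sm_oadd[symmetric])
    also have "\<dots> = Some (bnd h m y)"
      by (simp add: mul_add_left[OF eq] Sm_bnd m h)
    finally show ?thesis .
  qed
  then show ?thesis
    unfolding addW_eq_Some using bnd_Wt[OF m h] by blast
qed

section \<open>Unit laws and diagonal kernels\<close>

lemma kernel_eta: "kernel (eta A)"
  unfolding kernel_def by (simp add: eta_Wt)

lemma kernel_lscale_eta: "kernel (\<lambda>x. lscale A (u x) (eta A x))"
  unfolding kernel_def by (simp add: eta_Wt lscale_Wt)

text \<open>Only the term at \<open>y\<close> survives. The factor to the left of \<open>eta\<close>
  ends up to the right of \<open>m\<close>, which is why the rule \<open>Assume\<close> scales its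
  postcondition from the right.\<close>

lemma bnd_lscale_eta:
  assumes "m \<in> Wt A"
  shows "bnd (\<lambda>x. lscale A (u x) (eta A x)) m = (\<lambda>y. m y \<odot> u y)"
proof (rule bnd_eqI)
  show "Sm (\<lambda>x. Some (m x \<odot> lscale A (u x) (eta A x) y)) UNIV = Some (m y \<odot> u y)" for y
    by (subst Sm_single[of y]) (auto simp: lscale_def eta_def)
qed (use assms kernel_lscale_eta in auto)

lemma bnd_eta: "m \<in> Wt A \<Longrightarrow> bnd (eta A) m = m"
  using bnd_lscale_eta[of m "\<lambda>x. \<one>"] by (simp add: lscale_def)

lemma bnd_of_eta:
  assumes "kernel f"
  shows "bnd f (eta A x) = f x"
proof (rule bnd_eqI)
  show "Sm (\<lambda>z. Some (eta A x z \<odot> f z y)) UNIV = Some (f x y)" for y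
    by (subst Sm_single[of x]) (auto simp: eta_def)
qed (use assms eta_Wt in auto)

section \<open>Loops\<close>

text \<open>This is the semantics of \<open>Assume e\<close>; for the exit guard it is also the
  second summand of \<open>Phi\<close>.\<close>

definition guard :: "('t \<Rightarrow> 's set) \<Rightarrow> ('t, 'u) expr \<Rightarrow> 's \<Rightarrow> 's \<Rightarrow> 'u" where
  "guard tst e \<sigma> = lscale A (evalE A tst e \<sigma>) (eta A \<sigma>)"

lemma kernel_guard: "kernel (guard tst e)"
  unfolding guard_def by (rule kernel_lscale_eta)

lemma bnd_guard: "m \<in> Wt A \<Longrightarrow> bnd (guard tst e) m = (\<lambda>\<sigma>. m \<sigma> \<odot> evalE A tst e \<sigma>)"
  unfolding guard_def by (rule bnd_lscale_eta)

lemma bnd_of_guard: "kernel g \<Longrightarrow> bnd g (guard tst e \<sigma>) = lscale A (evalE A tst e \<sigma>) (g \<sigma>)"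
  unfolding guard_def by (simp add: bnd_lscale bnd_of_eta eta_Wt)

text \<open>One guarded iteration, that is the semantics of \<open>Seq (Assume e) C\<close>, in the
  form in which the rule \<open>Iter\<close> mentions it.\<close>

definition body :: "('t \<Rightarrow> 's set) \<Rightarrow> ('t, 'u) expr \<Rightarrow> ('s \<Rightarrow> 's \<Rightarrow> 'u) \<Rightarrow> 's \<Rightarrow> 's \<Rightarrow> 'u" where
  "body tst e g = (\<lambda>\<sigma>. bnd g (guard tst e \<sigma>))"

lemma kernel_bnd: "kernel f \<Longrightarrow> kernel g \<Longrightarrow> kernel (\<lambda>x. bnd g (f x))"
  unfolding kernel_def using bnd_Wt unfolding kernel_def by blast

lemma kernel_body: "kernel g \<Longrightarrow> kernel (body tst e g)"
  unfolding body_def by (intro kernel_bnd kernel_guard)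

lemma liftF_eq_Some: "liftF r = Some f \<longleftrightarrow> (\<forall>\<sigma>. r \<sigma> = Some (f \<sigma>))"
  using Some_the_fun_iff[of r UNIV f] unfolding liftF_def by simp

text \<open>By \<open>bnd_lscale\<close> the weight of the guard moves inside the extension and onto
  the loop body. The functional then reads: one guarded iteration followed by \<open>f\<close>, plus
  the exit.\<close>

lemma Phi_eq_Some:
  assumes g: "kernel g" and f: "kernel f"
  shows "Phi A tst g e e' f = Some f' \<longleftrightarrow>
    (\<forall>\<sigma>. addW A (bnd f (body tst e g \<sigma>)) (guard tst e' \<sigma>) = Some (f' \<sigma>))"
proof -
  have "lscale A (evalE A tst e \<sigma>) (bnd f (g \<sigma>)) = bnd f (body tst e g \<sigma>)" for \<sigma>
    using f g unfolding body_def bnd_of_guard[OF g] by (simp add: bnd_lscale kernel_def)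
  moreover have "bindW A f (g \<sigma>) = Some (bnd f (g \<sigma>))" for \<sigma>
    using f g by (simp add: bindW_bnd kernel_def)
  ultimately show ?thesis
    unfolding Phi_def liftF_eq_Some by (simp add: guard_def)
qed

text \<open>The contribution of the runs that leave the loop after exactly n iterations.\<close>

primrec unroll :: "('s \<Rightarrow> 's \<Rightarrow> 'u) \<Rightarrow> ('s \<Rightarrow> 's \<Rightarrow> 'u) \<Rightarrow> nat \<Rightarrow> 's \<Rightarrow> 's \<Rightarrow> 'u" where
  "unroll h w 0 = w"
| "unroll h w (Suc n) = (\<lambda>\<sigma>. bnd (unroll h w n) (h \<sigma>))"

lemma kernel_unroll: "kernel h \<Longrightarrow> kernel w \<Longrightarrow> kernel (unroll h w n)"
  by (induction n) (auto intro: kernel_bnd)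

text \<open>\<open>unroll\<close> prepends iterations to a kernel, whereas the rule
  \<open>Iter\<close> follows the successive images of \<open>m\<close>. Associativity of the
  extension translates one into the other.\<close>

lemma bnd_unroll:
  assumes "kernel h" "kernel w" "m \<in> Wt A"
  shows "bnd (unroll h w n) m = bnd w ((bnd h ^^ n) m)"
  using assms(3)
proof (induction n arbitrary: m)
  case (Suc n)
  have "bnd (unroll h w (Suc n)) m = bnd (unroll h w n) (bnd h m)"
    using bnd_bnd[OF Suc.prems assms(1) kernel_unroll[OF assms(1,2)]] by simp
  also have "\<dots> = bnd w ((bnd h ^^ n) (bnd h m))"
    using Suc bnd_Wt assms by blast
  finally show ?case by (simp add: funpow_swap1)
qed simp

text \<open>Induction on \<open>N\<close> for an arbitrary fixed point \<open>f\<close>: the terms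
  with at least one iteration are bounded by the extension of \<open>f\<close> at
  \<open>h \<sigma>\<close>, the term at 0 is \<open>w\<close>, and the fixed-point equation adds
  them up to \<open>f\<close>.\<close>

lemma unroll_sum_bound:
  assumes h: "kernel h" and w: "kernel w" and f: "kernel f"
    and fix_eq: "\<And>\<sigma>. addW A (bnd f (h \<sigma>)) (w \<sigma>) = Some (f \<sigma>)"
  shows "Sm (\<lambda>n. Some (unroll h w n \<sigma> y)) {..<N} \<sqsubseteq> Some (f \<sigma> y)"
proof (induction N arbitrary: \<sigma> y)
  case 0
  then show ?case by (simp add: Sm_finite zero_nleq)
next
  case (Suc N)
  have hW: "h \<sigma> \<in> Wt A" using h unfolding kernel_def by blast
  \<comment> \<open>The induction hypothesis multiplied by a fixed weight. The partial sum is
    defined because it is bounded, so multiplication distributes over it.\<close>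
  have step: "Sm (\<lambda>n. Some (u \<odot> unroll h w n \<tau> y)) {..<N} \<sqsubseteq> Some (u \<odot> f \<tau> y)" for u \<tau>
  proof -
    obtain s where s: "Sm (\<lambda>n. Some (unroll h w n \<tau> y)) {..<N} = Some s"
      using ole_defined[OF Suc.IH] by blast
    then have "nleq A s (f \<tau> y)" using Suc.IH[of \<tau> y] by simp
    then show ?thesis unfolding Sm_mul_left[OF s] by (simp add: nleq_mul_left)
  qed
  have "Sm (\<lambda>n. Some (unroll h w (Suc n) \<sigma> y)) {..<N}
      = Sm (\<lambda>n. Sm (\<lambda>x. Some (h \<sigma> x \<odot> unroll h w n x y)) UNIV) {..<N}"
    unfolding unroll.simps by (intro Sm_cong Sm_bnd[symmetric] hW kernel_unroll h w)
  also have "\<dots> = Sm (\<lambda>x. Sm (\<lambda>n. Some (h \<sigma> x \<odot> unroll h w n x y)) {..<N}) UNIV"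
    by (rule Sm_swap)
  also have "\<dots> \<sqsubseteq> Sm (\<lambda>x. Some (h \<sigma> x \<odot> f x y)) UNIV"
    by (intro Sm_mono step)
  also have "\<dots> = Some (bnd f (h \<sigma>) y)"
    by (rule Sm_bnd[OF hW f])
  finally have "Sm (\<lambda>n. Some (unroll h w n \<sigma> y)) {..<Suc N} \<sqsubseteq> Some (w \<sigma> y) \<oplus> Some (bnd f (h \<sigma>) y)"
    unfolding Sm_lessThan_Suc unroll.simps(1) by (intro oadd_mono ole_refl)
  also have "\<dots> = Some (f \<sigma> y)"
    using fix_eq[of \<sigma>] unfolding addW_eq_Some by (simp add: sadd_commute)
  finally show ?case .
qed

text \<open>The fixed point \<open>f\<close> bounds all finite partial sums, so the infinite sum
  \<open>s\<close> is defined, and countable support and defined mass are inherited from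
  \<open>f\<close>. Splitting off the term at 0 shows that \<open>s\<close> is itself a fixed
  point.\<close>

lemma unroll_sum:
  assumes h: "kernel h" and w: "kernel w" and f: "kernel f"
    and fix_eq: "\<And>\<sigma>. addW A (bnd f (h \<sigma>)) (w \<sigma>) = Some (f \<sigma>)"
  obtains s where "kernel s" "\<And>\<sigma>. sumW A (\<lambda>n. unroll h w n \<sigma>) UNIV = Some (s \<sigma>)"
    "\<And>\<sigma> y. nleq A (s \<sigma> y) (f \<sigma> y)" "\<And>\<sigma>. addW A (bnd s (h \<sigma>)) (w \<sigma>) = Some (s \<sigma>)"
proof -
  have bound: "Sm (\<lambda>n. Some (unroll h w n \<sigma> y)) UNIV \<sqsubseteq> Some (f \<sigma> y)" for \<sigma> y
  proof (rule Sm_least)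
    fix F :: "nat set" assume "finite F"
    then obtain N where "F \<subseteq> {..<N}" using finite_nat_iff_bounded by blast
    with \<open>finite F\<close> have "osum.F (\<lambda>n. Some (unroll h w n \<sigma> y)) F
        \<sqsubseteq> Sm (\<lambda>n. Some (unroll h w n \<sigma> y)) {..<N}"
      by (rule finite_sum_ole_Sm)
    also have "\<dots> \<sqsubseteq> Some (f \<sigma> y)" by (rule unroll_sum_bound[OF assms])
    finally show "osum.F (\<lambda>n. Some (unroll h w n \<sigma> y)) F \<sqsubseteq> Some (f \<sigma> y)" .
  qed
  define s where "s = (\<lambda>\<sigma> y. the (Sm (\<lambda>n. Some (unroll h w n \<sigma> y)) UNIV))"
  have s: "Sm (\<lambda>n. Some (unroll h w n \<sigma> y)) UNIV = Some (s \<sigma> y)" for \<sigma> y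
    using ole_defined[OF bound] unfolding s_def by simp
  have le: "nleq A (s \<sigma> y) (f \<sigma> y)" for \<sigma> y
    using bound[of \<sigma> y] unfolding s by simp
  have ks: "kernel s"
    unfolding kernel_def
  proof
    show "s \<sigma> \<in> Wt A" for \<sigma>
      using f unfolding kernel_def by (intro Wt_downward[OF _ le]) blast
  qed
  then have sum: "sumW A (\<lambda>n. unroll h w n \<sigma>) UNIV = Some (s \<sigma>)" for \<sigma>
    unfolding sumW_eq_Some kernel_def using s by blast
  have "addW A (bnd s (h \<sigma>)) (w \<sigma>) = Some (s \<sigma>)" for \<sigma>
  proof -
    have "h \<sigma> \<in> Wt A" using h unfolding kernel_def by blast
    \<comment> \<open>By linearity in the kernel, applying \<open>s\<close> after one more iteration
      yields exactly the tail of the series from index 1 on.\<close>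
    then have "sumW A (\<lambda>n. bnd (unroll h w n) (h \<sigma>)) UNIV = Some (bnd s (h \<sigma>))"
      by (rule sumW_bnd_right[OF sum kernel_unroll[OF h w]])
    then have "Sm (\<lambda>n. Some (unroll h w (Suc n) \<sigma> y)) UNIV = Some (bnd s (h \<sigma>) y)" for y
      unfolding sumW_eq_Some unroll.simps by blast
    then have "Some (s \<sigma> y) = Some (w \<sigma> y) \<oplus> Some (bnd s (h \<sigma>) y)" for y
      using s[of \<sigma> y] unfolding Sm_nat[of "\<lambda>n. Some (unroll h w n \<sigma> y)"] by simp
    then show ?thesis
      using ks unfolding addW_eq_Some kernel_def by (simp add: sadd_commute)
  qed
  then show thesis using that ks sum le by blast
qed

section \<open>The least fixed point as a sum over iteration counts\<close>

lemma sqF_nleq: "sqF A f g \<Longrightarrow> nleq A (f \<sigma> x) (g \<sigma> x)"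
  unfolding sqF_def sqW_def addW_eq_Some nleq_def by blast

text \<open>To unfold the definite description, uniqueness is needed: \<open>sqF\<close> implies the
  pointwise natural order, which is antisymmetric.\<close>

lemma lfpW_Some:
  assumes "lfpW A F = Some f"
  shows "kernel f" "F f = Some f" "\<And>g. kernel g \<Longrightarrow> F g = Some g \<Longrightarrow> sqF A f g"
proof -
  define FP where "FP = {f. (\<forall>\<sigma>. f \<sigma> \<in> Wt A) \<and> F f = Some f}"
  define least where "least f \<longleftrightarrow> f \<in> FP \<and> (\<forall>g\<in>FP. sqF A f g)" for f
  have ex: "\<exists>f. least f" and f: "f = (THE f. least f)"
    using assms unfolding lfpW_def Let_def FP_def[symmetric] least_def
    by (auto split: if_splits)
  have "x = y" if "least x" "least y" for x y
  proof (intro ext)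
    have "sqF A x y" "sqF A y x" using that unfolding least_def by blast+
    then show "x \<sigma> z = y \<sigma> z" for \<sigma> z
      by (intro nleq_antisym[of "x \<sigma> z"] sqF_nleq[of x y] sqF_nleq[of y x])
  qed
  with ex have "\<exists>!f. least f" by blast
  then have "least f" unfolding f by (rule theI')
  then show "kernel f" "F f = Some f" "\<And>g. kernel g \<Longrightarrow> F g = Some g \<Longrightarrow> sqF A f g"
    unfolding least_def FP_def kernel_def by auto
qed

text \<open>The sum \<open>s\<close> is pointwise below the least fixed point \<open>f\<close> by
  the bound on partial sums, and \<open>f\<close> is below \<open>s\<close> because \<open>s\<close>
  is a fixed point. Antisymmetry identifies them.\<close>

lemma lfpW_Phi_sum:
  assumes g: "kernel g" and lfp: "lfpW A (Phi A tst g e e') = Some f"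
  shows "sumW A (\<lambda>n. unroll (body tst e g) (guard tst e') n \<sigma>) UNIV = Some (f \<sigma>)"
proof -
  note f = lfpW_Some[OF lfp]
  have "addW A (bnd f (body tst e g \<tau>)) (guard tst e' \<tau>) = Some (f \<tau>)" for \<tau>
    using f(2) unfolding Phi_eq_Some[OF g f(1)] by blast
  then obtain s where s: "kernel s"
    "\<And>\<sigma>. sumW A (\<lambda>n. unroll (body tst e g) (guard tst e') n \<sigma>) UNIV = Some (s \<sigma>)"
    "\<And>\<sigma> y. nleq A (s \<sigma> y) (f \<sigma> y)"
    "\<And>\<sigma>. addW A (bnd s (body tst e g \<sigma>)) (guard tst e' \<sigma>) = Some (s \<sigma>)"
    using unroll_sum[OF kernel_body[OF g] kernel_guard f(1)] by blast
  have "sqF A f s"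
    using f(3)[OF s(1)] s(4) unfolding Phi_eq_Some[OF g s(1)] by blast
  then have "f = s"
    by (intro ext nleq_antisym s(3) sqF_nleq[of f s])
  then show ?thesis using s(2) by simp
qed

section \<open>Soundness\<close>

lemma sem_Seq_Some:
  "sem A act tst (Seq C1 C2) = Some h \<longleftrightarrow> (\<exists>f g. sem A act tst C1 = Some f \<and>
    sem A act tst C2 = Some g \<and> (\<forall>\<sigma>. bindW A g (f \<sigma>) = Some (h \<sigma>)))"
  by (auto simp: liftF_eq_Some split: option.splits)

lemma sem_Plus_Some:
  "sem A act tst (Plus C1 C2) = Some h \<longleftrightarrow> (\<exists>f g. sem A act tst C1 = Some f \<and>
    sem A act tst C2 = Some g \<and> (\<forall>\<sigma>. addW A (f \<sigma>) (g \<sigma>) = Some (h \<sigma>)))"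
  by (auto simp: liftF_eq_Some split: option.splits)

lemma sem_Iter_Some:
  "sem A act tst (Iter C e e') = Some h \<longleftrightarrow>
    (\<exists>g. sem A act tst C = Some g \<and> lfpW A (Phi A tst g e e') = Some h)"
  by (auto split: option.splits)

lemma sem_Assume: "sem A act tst (Assume e) = Some (guard tst e)"
  by (simp add: guard_def[abs_def])

lemma sem_kernel:
  assumes "\<forall>a \<sigma>. act a \<sigma> \<in> Wt A"
  shows "sem A act tst C = Some f \<Longrightarrow> kernel f"
proof (induction C arbitrary: f)
  case Skip
  then have "f = eta A" by simp
  then show ?case using kernel_eta by blast
next
  case (Seq C1 C2)
  then show ?case unfolding sem_Seq_Some bindW_eq_Some kernel_def by blast
next
  case (Plus C1 C2)
  then show ?case unfolding sem_Plus_Some addW_eq_Some kernel_def by blast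
next
  case (Assume e)
  then show ?case unfolding sem_Assume using kernel_guard by blast
next
  case (Iter C e e')
  then show ?case unfolding sem_Iter_Some using lfpW_Some(1) by blast
next
  case (Atom a)
  then show ?case using assms by (auto simp: kernel_def)
qed

lemma sem_Seq_bnd:
  assumes act: "\<forall>a \<sigma>. act a \<sigma> \<in> Wt A"
    and "sem A act tst C1 = Some f" and "sem A act tst C2 = Some g"
  shows "sem A act tst (Seq C1 C2) = Some (\<lambda>\<sigma>. bnd g (f \<sigma>))"
proof -
  have "bindW A g (f \<sigma>) = Some (bnd g (f \<sigma>))" for \<sigma>
    using sem_kernel[OF act assms(2)] sem_kernel[OF act assms(3)]
    by (intro bindW_bnd) (auto simp: kernel_def)
  then show ?thesis unfolding sem_Seq_Some using assms(2,3) by blast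
qed

text \<open>An invariant of derivations that places every input in \<open>Wt A\<close>, where the
  laws of \<open>bnd\<close> are available.\<close>

lemma derives_Wt:
  assumes "\<Gamma> \<subseteq> {(\<phi>, a, \<psi>). \<phi> \<subseteq> Wt A \<and> \<psi> \<subseteq> Wt A}"
  shows "derives A tst \<Gamma> idx \<phi> C \<psi> \<Longrightarrow> \<phi> \<subseteq> Wt A \<and> \<psi> \<subseteq> Wt A"
proof (induction rule: derives.induct)
  case (Ax \<phi> a \<psi>)
  then show ?case using assms by blast
next
  case (Plus \<phi> C1 \<psi>1 C2 \<psi>2)
  then show ?case unfolding oplus_def addW_eq_Some by blast
next
  case (Assume \<phi> e u)
  then show ?case unfolding rscaleS_def using rscale_Wt by blast
next
  case (Scale \<phi> C \<psi> u)
  then show ?case unfolding lscaleS_def using lscale_Wt by blast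
next
  case (Choice T \<Phi> C \<Phi>')
  then show ?case unfolding bigoplus_def sumW_eq_Some by blast
next
  case (Exists T \<Phi> C \<Phi>')
  then show ?case by blast
qed blast+

lemma derives_Omega_Wt:
  "derives A tst (Omega A act tst) idx \<phi> C \<psi> \<Longrightarrow> \<phi> \<subseteq> Wt A \<and> \<psi> \<subseteq> Wt A"
  by (rule derives_Wt) (auto simp: Omega_def)

text \<open>Rule induction with \<open>bnd\<close> in place of \<open>bindW\<close>, so that
  definedness of the extension does not have to be carried along. Totality of the semantics passes
  from a program to its components.\<close>

lemma derives_sound:
  assumes act: "\<forall>a \<sigma>. act a \<sigma> \<in> Wt A"
  shows "derives A tst (Omega A act tst) idx \<phi> C \<psi> \<Longrightarrow> sem A act tst C = Some f \<Longrightarrow> m \<in> \<phi>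
    \<Longrightarrow> bnd f m \<in> \<psi>"
proof (induction arbitrary: f m rule: derives.induct)
  case (Ax \<phi> a \<psi>)
  then obtain m' where "bindW A f m = Some m'" "m' \<in> \<psi>"
    unfolding Omega_def valid_def by fastforce
  then show ?case unfolding bnd_def by simp
next
  case (Skip \<phi>)
  then have "f = eta A" "m \<in> Wt A" by auto
  then show ?case using bnd_eta Skip.prems(2) by metis
next
  case (Seq \<phi> C1 \<theta> C2 \<psi>)
  from Seq.prems(1) obtain f1 f2 where f12: "sem A act tst C1 = Some f1" "sem A act tst C2 = Some f2"
    unfolding sem_Seq_Some by blast
  have "m \<in> Wt A" using derives_Omega_Wt[OF Seq.hyps(1)] Seq.prems(2) by blast
  moreover have "f = (\<lambda>\<sigma>. bnd f2 (f1 \<sigma>))"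
    using sem_Seq_bnd[OF act f12] Seq.prems(1) by simp
  ultimately have "bnd f m = bnd f2 (bnd f1 m)"
    using bnd_bnd[OF _ sem_kernel[OF act f12(1)] sem_kernel[OF act f12(2)]] by simp
  then show ?case using Seq.IH f12 Seq.prems(2) by simp
next
  case (Plus \<phi> C1 \<psi>1 C2 \<psi>2)
  from Plus.prems(1) obtain f1 f2 where f12: "sem A act tst C1 = Some f1" "sem A act tst C2 = Some f2"
    and add: "\<And>\<sigma>. addW A (f1 \<sigma>) (f2 \<sigma>) = Some (f \<sigma>)"
    unfolding sem_Plus_Some by blast
  have "m \<in> Wt A" using derives_Omega_Wt[OF Plus.hyps(1)] Plus.prems(2) by blast
  then have "addW A (bnd f1 m) (bnd f2 m) = Some (bnd f m)"
    by (intro addW_bnd[of f1 f2 f, OF add sem_kernel[OF act f12(1)] sem_kernel[OF act f12(2)]])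
  then show ?case using Plus.IH f12 Plus.prems(2) unfolding oplus_def by blast
next
  case (Assume \<phi> e u)
  have m: "m \<in> Wt A" using Assume by blast
  \<comment> \<open>The side condition speaks about the support only; elsewhere both products are
    zero.\<close>
  have "m \<sigma> \<odot> evalE A tst e \<sigma> = m \<sigma> \<odot> u" for \<sigma>
    using Assume.hyps(2) Assume.prems(2) unfolding supp_def by (cases "m \<sigma> = \<zero>") auto
  moreover have "f = guard tst e" using Assume.prems(1) unfolding sem_Assume by simp
  ultimately have "bnd f m = rscale A m u" unfolding rscale_def by (simp add: bnd_guard m)
  then show ?case using Assume.prems(2) unfolding rscaleS_def by blast
next
  case (Iter \<psi>s \<psi>inf \<phi>s e C e')
  from Iter.prems(1) obtain g where g: "sem A act tst C = Some g"
    and lfp: "lfpW A (Phi A tst g e e') = Some f"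
    unfolding sem_Iter_Some by blast
  have kg: "kernel g" by (rule sem_kernel[OF act g])
  let ?h = "body tst e g"
  let ?w = "guard tst e'"
  have kh: "kernel ?h" by (rule kernel_body[OF kg])
  have kw: "kernel ?w" by (rule kernel_guard)
  have \<phi>s: "\<phi>s n \<subseteq> Wt A" for n
    using derives_Omega_Wt Iter.IH(2) by blast
  \<comment> \<open>The first premise of the rule concerns this composite program, so its induction
    hypothesis applies to \<open>body\<close> and moves each iterate of \<open>m\<close> to the next
    assertion.\<close>
  have sem_h: "sem A act tst (Seq (Assume e) C) = Some ?h"
    unfolding body_def by (rule sem_Seq_bnd[OF act sem_Assume g])
  have iter: "(bnd ?h ^^ n) m \<in> \<phi>s n" for n
  proof (induction n)
    case 0
    then show ?case using Iter.prems(2) by simp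
  next
    case (Suc n)
    then show ?case using Iter.IH(1) sem_h by simp
  qed
  have m: "m \<in> Wt A" using \<phi>s Iter.prems(2) by blast
  have "bnd (unroll ?h ?w n) m \<in> \<psi>s n" for n
    unfolding bnd_unroll[OF kh kw m] using Iter.IH(2) iter sem_Assume by blast
  moreover have "sumW A (\<lambda>n. bnd (unroll ?h ?w n) m) UNIV = Some (bnd f m)"
    by (rule sumW_bnd_right[OF lfpW_Phi_sum[OF kg lfp] kernel_unroll[OF kh kw] m])
  \<comment> \<open>\<open>converges\<close> provides some sum that lies in the limit assertion;
    since \<open>sumW\<close> is a function, that sum is \<open>bnd f m\<close>.\<close>
  ultimately show ?case
    using Iter.hyps(1) unfolding converges_def by (metis (no_types, lifting) option.inject)
next
  case (False \<phi> C)
  then show ?case by simp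
next
  case (True \<phi> C)
  then show ?case using bnd_Wt sem_kernel[OF act] by blast
next
  case (Scale \<phi> C \<psi> u)
  from Scale.prems(2) obtain m' where m': "m' \<in> \<phi>" "m = lscale A u m'"
    unfolding lscaleS_def by blast
  have "m' \<in> Wt A" using derives_Omega_Wt[OF Scale.hyps] m'(1) by blast
  then have "bnd f m = lscale A u (bnd f m')"
    unfolding m'(2) by (rule bnd_lscale[OF _ sem_kernel[OF act Scale.prems(1)]])
  then show ?case using Scale.IH[OF Scale.prems(1) m'(1)] unfolding lscaleS_def by blast
next
  case (Disj \<phi>1 C \<psi>1 \<phi>2 \<psi>2)
  then show ?case by blast
next
  case (Conj \<phi>1 C \<psi>1 \<phi>2 \<psi>2)
  then show ?case by blast
next
  case (Choice T \<Phi> C \<Phi>')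
  from Choice.prems(2) obtain ms where ms: "\<And>t. t \<in> T \<Longrightarrow> ms t \<in> \<Phi> t" "sumW A ms T = Some m"
    unfolding bigoplus_def by blast
  have "ms t \<in> Wt A" if "t \<in> T" for t
    using derives_Omega_Wt Choice.IH ms(1) that by blast
  \<comment> \<open>By linearity in the argument, the images of the summands form a witness for the
    postcondition.\<close>
  then have "sumW A (\<lambda>t. bnd f (ms t)) T = Some (bnd f m)"
    by (intro sumW_bnd_left[OF ms(2)] sem_kernel[OF act Choice.prems(1)])
  moreover have "\<forall>t\<in>T. bnd f (ms t) \<in> \<Phi>' t"
    using Choice.IH Choice.prems(1) ms(1) by blast
  ultimately show ?case
    unfolding bigoplus_def by (intro CollectI exI[of _ "\<lambda>t. bnd f (ms t)"] conjI)
next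
  case (Exists T \<Phi> C \<Phi>')
  then show ?case by blast
next
  case (Consequence \<phi>' \<phi> C \<psi> \<psi>')
  then show ?case by blast
qed

end

theorem theorem3p3:
  fixes A :: "'u psemiring" and act :: "'a \<Rightarrow> 's \<Rightarrow> 's \<Rightarrow> 'u" and tst :: "'t \<Rightarrow> 's set"
    and C :: "('a, 't, 'u) prog" and \<phi> \<psi> :: "('s \<Rightarrow> 'u) set"
  assumes "standing_assumptions A"
    and "\<forall>a \<sigma>. act a \<sigma> \<in> Wt A"
    and "well_formed A act tst C"
    and "\<phi> \<subseteq> Wt A" and "\<psi> \<subseteq> Wt A"
    and "derives A tst (Omega A act tst) TYPE('i) \<phi> C \<psi>"
  shows "valid A act tst \<phi> C \<psi>"
proof -
  interpret weights A by unfold_locales (rule assms(1))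
  obtain f where f: "sem A act tst C = Some f"
    using assms(3) unfolding well_formed_def by blast
  \<comment> \<open>Validity also demands that the extension is defined; \<open>bindW_bnd\<close>
    supplies this for weighted maps.\<close>
  have "bindW A f m = Some (bnd f m) \<and> bnd f m \<in> \<psi>" if "m \<in> \<phi>" for m
    using bindW_bnd[OF _ sem_kernel[OF assms(2) f]] derives_sound[OF assms(2,6) f that] that assms(4)
    by blast
  then show ?thesis using f unfolding valid_def by blast
qed

end
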